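(* Let $n\ge 1$. The smallest geodetically convex subset of the Heisenberg group $\mathbb{H}^n$ containing two distinct points lying on a line parallel to the $t$-axis (i.e. two points $(x,y,t)$ and $(x,y,t')$ with $t\ne t'$) is the whole space $\mathbb{H}^n$.
   Context: The Heisenberg group is $\mathbb{H}^n=\{(x,y,t): x,y\in\mathbb{R}^n,\ t\in\mathbb{R}\}$ with group law $(x,y,t)*(\tilde x,\tilde y,\tilde t)=\bigl(x+\tilde x,\,y+\tilde y,\,t+\tilde t+2\sum_{i=1}^n(\tilde x_i y_i-x_i\tilde y_i)\bigr)$. Its horizontal space at $p$ is the span of $X_i=\partial_{x_i}+2y_i\partial_t$ and $Y_i=\partial_{y_i}-2x_i\partial_t$, $1\le i\le n$, at $p$. An absolutely continuous curve $\Gamma$ in $\mathbb{H}^n$ is horizontal if its velocity lies in the horizontal space for almost every parameter; writing $\Gamma=(x(s),y(s),t(s))$ this means $\dot t=2\sum_{j=1}^n(\dot x_jy_j-\dot y_jx_j)$ almost everywhere. The $\mathbb{H}^n$-length of a horizontal curve $\Gamma:[0,S]\to\mathbb{H}^n$ is the Euclidean length $\int_0^S|\dot\gamma(s)|\,ds$ of its projection $\gamma=(x(s),y(s))$ to $\mathbb{R}^{2n}$. A geodesic connecting two points is a horizontal curve of shortest $\mathbb{H}^n$-length among all horizontal curves connecting them. A subset $X\subseteq\mathbb{H}^n$ is geodetically convex if every geodesic connecting every pair of points in $X$ lies in $X$. *)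

theory Defs
  imports "HOL-Analysis.Analysis"
begin

text \<open>
  The product norm on this type is Euclidean. The dimension \<open>n\<close> is \<open>CARD('n)\<close>, which
  is at least 1.
\<close>

type_synonym 'n heis = "(real ^ 'n) \<times> (real ^ 'n) \<times> real"

definition heis_mult :: "'n::finite heis \<Rightarrow> 'n heis \<Rightarrow> 'n heis" where
  "heis_mult = (\<lambda>(x, y, t) (x', y', t').
     (x + x', y + y', t + t' + 2 * (\<Sum>i\<in>UNIV. x' $ i * y $ i - x $ i * y' $ i)))"

text \<open>
  Vector fields are identified with their coefficient vectors in the global coordinates
  \<open>(x, y, t)\<close>.
\<close>

definition heis_X :: "'n::finite \<Rightarrow> 'n heis \<Rightarrow> 'n heis" where
  "heis_X i = (\<lambda>(x, y, t). (axis i 1, 0, 2 * y $ i))"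

definition heis_Y :: "'n::finite \<Rightarrow> 'n heis \<Rightarrow> 'n heis" where
  "heis_Y i = (\<lambda>(x, y, t). (0, axis i 1, - 2 * x $ i))"

definition horizontal_space :: "'n::finite heis \<Rightarrow> 'n heis set" where
  "horizontal_space p = span ((\<lambda>i. heis_X i p) ` UNIV \<union> (\<lambda>i. heis_Y i p) ` UNIV)"

text \<open>
  The usual \<open>\<epsilon>\<close>-\<open>\<delta>\<close> condition on finite families of non-overlapping compact subintervals
  of \<open>{a..b}\<close>; such a family is a division of its own union.
\<close>

definition abs_continuous_on_ivl :: "real \<Rightarrow> real \<Rightarrow> (real \<Rightarrow> 'a::real_normed_vector) \<Rightarrow> bool" where
  "abs_continuous_on_ivl a b f \<longleftrightarrow>
     (\<forall>e>0. \<exists>d>0. \<forall>D. D division_of (\<Union>D) \<and> \<Union>D \<subseteq> {a..b} \<and> (\<Sum>k\<in>D. Sup k - Inf k) < d \<longrightarrow>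
        (\<Sum>k\<in>D. norm (f (Sup k) - f (Inf k))) < e)"

text \<open>
  Only the values of a curve on its parameter interval \<open>{0..S}\<close> matter. The existence of the
  velocity almost everywhere is automatic for an absolutely continuous curve.
\<close>

definition horizontal_curve :: "real \<Rightarrow> (real \<Rightarrow> 'n::finite heis) \<Rightarrow> bool" where
  "horizontal_curve S \<Gamma> \<longleftrightarrow> abs_continuous_on_ivl 0 S \<Gamma> \<and>
     (AE s in lebesgue_on {0..S}.
        \<exists>v\<in>horizontal_space (\<Gamma> s). (\<Gamma> has_vector_derivative v) (at s within {0..S}))"

definition heis_proj :: "'n::finite heis \<Rightarrow> (real ^ 'n) \<times> (real ^ 'n)" where
  "heis_proj = (\<lambda>(x, y, t). (x, y))"

definition heis_length :: "real \<Rightarrow> (real \<Rightarrow> 'n::finite heis) \<Rightarrow> real" where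
  "heis_length S \<Gamma> =
     integral {0..S} (\<lambda>s. norm (vector_derivative (heis_proj \<circ> \<Gamma>) (at s within {0..S})))"

definition connects :: "real \<Rightarrow> (real \<Rightarrow> 'n::finite heis) \<Rightarrow> 'n heis \<Rightarrow> 'n heis \<Rightarrow> bool" where
  "connects S \<Gamma> p q \<longleftrightarrow> 0 < S \<and> horizontal_curve S \<Gamma> \<and> \<Gamma> 0 = p \<and> \<Gamma> S = q"

definition geodesic :: "real \<Rightarrow> (real \<Rightarrow> 'n::finite heis) \<Rightarrow> 'n heis \<Rightarrow> 'n heis \<Rightarrow> bool" where
  "geodesic S \<Gamma> p q \<longleftrightarrow> connects S \<Gamma> p q \<and>
     (\<forall>S' \<Gamma>'. connects S' \<Gamma>' p q \<longrightarrow> heis_length S \<Gamma> \<le> heis_length S' \<Gamma>')"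

definition geodetically_convex :: "'n::finite heis set \<Rightarrow> bool" where
  "geodetically_convex X \<longleftrightarrow>
     (\<forall>p\<in>X. \<forall>q\<in>X. \<forall>S \<Gamma>. geodesic S \<Gamma> p q \<longrightarrow> \<Gamma> ` {0..S} \<subseteq> X)"

text \<open>
  Geodetic convexity is preserved by intersections, so \<open>geodetically_convex hull A\<close> is the
  smallest geodetically convex set containing \<open>A\<close>.
\<close>

lemma geodetically_convex_hull: "geodetically_convex (geodetically_convex hull A)"
  by (rule hull_in) (unfold geodetically_convex_def Ball_def, blast)

text \<open>\<open>X\<^sub>i\<close> and \<open>Y\<^sub>i\<close> are the left-invariant fields with values \<open>\<partial>\<^sub>x\<^sub>i\<close> and \<open>\<partial>\<^sub>y\<^sub>i\<close> at the origin.\<close>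

lemma heis_X_left_invariant: "heis_mult p (s *\<^sub>R axis i 1, 0, 0) = p + s *\<^sub>R heis_X i p"
  by (cases p) (auto simp: heis_mult_def heis_X_def axis_def if_distrib[of "\<lambda>z. _ * z"]
      if_distrib[of "\<lambda>z. z * _"] cong: if_cong)

lemma heis_Y_left_invariant: "heis_mult p (0, s *\<^sub>R axis i 1, 0) = p + s *\<^sub>R heis_Y i p"
  by (cases p) (auto simp: heis_mult_def heis_Y_def axis_def sum_negf if_distrib[of "\<lambda>z. _ * z"]
      if_distrib[of "\<lambda>z. z * _"] cong: if_cong)

lemma horizontal_space_iff:
  "(u, v, w) \<in> horizontal_space (x, y, t) \<longleftrightarrow>
     w = 2 * (\<Sum>j\<in>UNIV. u $ j * y $ j - v $ j * x $ j)"
proof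
  define H where "H = {(u, v, w). w = 2 * (\<Sum>j\<in>UNIV. u $ j * y $ j - v $ j * x $ j)}"
  have "subspace H"
    unfolding subspace_def
  proof (intro conjI ballI allI)
    show "0 \<in> H" by (auto simp: H_def zero_prod_def)
    show "p + q \<in> H" if "p \<in> H" "q \<in> H" for p q
      using that by (auto simp: H_def algebra_simps sum.distrib sum_subtractf)
    show "c *\<^sub>R p \<in> H" if "p \<in> H" for c p
      using that by (auto simp: H_def sum_distrib_left right_diff_distrib mult_ac)
  qed
  moreover have "heis_X i (x, y, t) \<in> H" "heis_Y i (x, y, t) \<in> H" for i
    by (auto simp: H_def heis_X_def heis_Y_def axis_def sum_negf if_distrib[of "\<lambda>z. z * _"]
        cong: if_cong)
  ultimately have "horizontal_space (x, y, t) \<subseteq> H"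
    unfolding horizontal_space_def by (intro span_minimal) auto
  then show "w = 2 * (\<Sum>j\<in>UNIV. u $ j * y $ j - v $ j * x $ j)"
    if "(u, v, w) \<in> horizontal_space (x, y, t)" using that by (auto simp: H_def)
next
  assume w: "w = 2 * (\<Sum>j\<in>UNIV. u $ j * y $ j - v $ j * x $ j)"
  let ?c = "(\<Sum>j\<in>UNIV. u $ j *\<^sub>R heis_X j (x, y, t)) + (\<Sum>j\<in>UNIV. v $ j *\<^sub>R heis_Y j (x, y, t))"
  have "?c = (u, v, w)"
    by (simp add: heis_X_def heis_Y_def sum_prod scaleR_vec_def axis_def vec_eq_iff w
        sum_subtractf sum_distrib_left sum_negf algebra_simps if_distrib[of "\<lambda>z. _ * z"]
        cong: if_cong)
  moreover have "?c \<in> horizontal_space (x, y, t)"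
    unfolding horizontal_space_def
    by (intro span_add span_sum span_scale span_base) auto
  ultimately show "(u, v, w) \<in> horizontal_space (x, y, t)" by simp
qed

end

theory Submission
  imports Defs
begin

text \<open>
  Write points as \<open>(z, t)\<close> with \<open>z \<in> \<real>\<^sup>2\<^sup>n\<close>. Along a horizontal curve that returns to its fibre, \<open>t\<close>
  changes by four times the symplectic area enclosed by the projection, up to sign. The isoperimetric
  inequality bounds the change by \<open>L\<^sup>2 / \<pi>\<close>, with equality for circles in complex lines. So all
  lifts of such circles through \<open>z\<close> with the right radius are geodesics between two given points of the fibre
  over \<open>z\<close> (\<open>geodesic_circle_lift\<close>). There are many of them, and the lower and the upper halves
  of these geodesics sweep out two points over each \<open>z + w\<close> with \<open>w\<close> in a ball (\<open>fibre_step\<close>).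

  A convex set that contains two points of one fibre therefore contains two points of each
  neighbouring fibre, and the construction can be repeated from there. The height lost in a step of length \<open>r\<close> is a
  circular segment, of order \<open>r\<^sup>3\<close> for a fixed gap, but a closed polygon with edges of length \<open>r\<close> changes the
  height by a multiple of its area, which is of order \<open>r\<^sup>2\<close> and of either sign. Four steps around a rhombus
  thus move the two original points apart, and also fill intervals around them (\<open>fibre_loop\<close>). By
  scaling, the new gap is at least a fixed factor larger than the old one, so the whole fibre is
  reached (\<open>fibre_subset\<close>), and from a full fibre everything is reached
  (\<open>geodetically_convex_eq_UNIV\<close>).

  The isoperimetric inequality (\<open>vertical_gap_le_length\<close>) has to hold for all absolutely continuous
  curves. It follows from its discrete form for closed polygons (\<open>polygon_isoperimetric\<close>), applied to
  polygons inscribed at equal arc lengths. The passage from the curve to its length and its height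
  is the fundamental theorem of calculus for absolutely continuous functions.
\<close>

section \<open>Absolutely continuous functions\<close>

lemma abs_continuous_on_subivl:
  assumes "abs_continuous_on_ivl a b f" "{c..d} \<subseteq> {a..b}"
  shows "abs_continuous_on_ivl c d f"
  using assms unfolding abs_continuous_on_ivl_def by (meson order_trans)

lemma division_sum_length_eq_measure:
  fixes D :: "real set set"
  assumes "D division_of S"
  shows "(\<Sum>k\<in>D. Sup k - Inf k) = measure lebesgue S"
proof -
  have "Sup k - Inf k = measure lebesgue k" if k: "k \<in> D" for k
  proof -
    obtain u v where uv: "k = cbox u v" "k \<noteq> {}"
      using division_ofD(3,4)[OF assms k] by blast
    then have "u \<le> v" by auto
    then show ?thesis using uv by (simp add: cbox_interval)
  qed
  then show ?thesis using content_division[OF assms] by (simp cong: sum.cong)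
qed

text \<open>
  In the Riemann sum for the gauge integral of the derivative, the terms with tag outside the null
  set \<open>N\<close> are controlled by differentiability, exactly as in the everywhere differentiable case.
  The intervals whose tag is in \<open>N\<close> are forced by the gauge into an open set of small measure
  around \<open>N\<close>, and absolute continuity makes the total increment of \<open>f\<close> over them small.
\<close>

lemma has_integral_abs_continuous:
  fixes f :: "real \<Rightarrow> 'a::euclidean_space"
  assumes ac: "abs_continuous_on_ivl a b f" and "a \<le> b" and N: "negligible N"
    and deriv: "\<And>x. x \<in> {a..b} - N \<Longrightarrow> (f has_vector_derivative f' x) (at x within {a..b})"
  shows "(f' has_integral (f b - f a)) {a..b}"
proof (cases "a = b")
  case True
  then show ?thesis by (simp add: has_integral_refl)
next
  case False
  then have "a < b" using \<open>a \<le> b\<close> by simp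
  \<comment> \<open>Setting the derivative to \<open>0\<close> on \<open>N\<close> leaves only the increments of \<open>f\<close> to estimate there.\<close>
  define g where "g x = (if x \<in> N then 0 else f' x)" for x
  have "(g has_integral (f b - f a)) {a..b}"
    unfolding has_integral_factor_content_real
  proof safe
    fix e :: real
    assume "e > 0"
    then have "e * (b - a) / 2 > 0" using \<open>a < b\<close> by simp
    then obtain d where "d > 0" and d:
      "\<And>D. D division_of (\<Union>D) \<Longrightarrow> \<Union>D \<subseteq> {a..b} \<Longrightarrow> (\<Sum>k\<in>D. Sup k - Inf k) < d \<Longrightarrow>
        (\<Sum>k\<in>D. norm (f (Sup k) - f (Inf k))) < e * (b - a) / 2"
      using ac unfolding abs_continuous_on_ivl_def by meson
    have nullN: "N \<in> null_sets lebesgue" using N negligible_iff_null_sets by blast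
    then obtain U where U: "open U" "N \<subseteq> U" "U - N \<in> lmeasurable"
      "emeasure lebesgue (U - N) < ennreal d"
      using sets_lebesgue_outer_open[of N d] \<open>d > 0\<close> by blast
    have Um: "U \<in> lmeasurable"
      using U(3) nullN
      by (metis Diff_partition U(2) fmeasurable.Un negligible_iff_measure N)
    have "emeasure lebesgue U = emeasure lebesgue (U - N)"
      using emeasure_Diff_null_set[OF nullN] U(1) by (simp add: borel_open)
    then have U_less: "measure lebesgue U < d"
      using U(4) \<open>d > 0\<close> emeasure_eq_measure2[OF Um]
      by (metis ennreal_less_iff measure_nonneg)
    have "\<forall>x. \<exists>r>0. x \<in> {a..b} - N \<longrightarrow>
         (\<forall>y\<in>{a..b}. norm (y-x) < r \<longrightarrow> norm (f y - f x - (y-x) *\<^sub>R f' x) \<le> e / 2 * norm (y-x))"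
    proof
      fix x
      show "\<exists>r>0. x \<in> {a..b} - N \<longrightarrow>
         (\<forall>y\<in>{a..b}. norm (y-x) < r \<longrightarrow> norm (f y - f x - (y-x) *\<^sub>R f' x) \<le> e / 2 * norm (y-x))"
      proof (cases "x \<in> {a..b} - N")
        case True
        then show ?thesis
          using deriv[OF True, unfolded has_vector_derivative_def has_derivative_within_alt] \<open>e > 0\<close>
            half_gt_zero[OF \<open>e > 0\<close>] by blast
      qed (use zero_less_one in blast)
    qed
    then obtain r where r: "\<And>x. 0 < r x"
      "\<And>x y. \<lbrakk>x \<in> {a..b} - N; y \<in> {a..b}; norm (y-x) < r x\<rbrakk>
                        \<Longrightarrow> norm (f y - f x - (y-x) *\<^sub>R f' x) \<le> e / 2 * norm (y-x)"
      by metis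
    define \<gamma> where "\<gamma> x = (if x \<in> N then U else ball x (r x))" for x
    show "\<exists>d. gauge d \<and> (\<forall>p. p tagged_division_of {a..b} \<and> d fine p \<longrightarrow>
        norm ((\<Sum>(x, k)\<in>p. measure lborel k *\<^sub>R g x) - (f b - f a)) \<le> e * measure lborel {a..b})"
    proof (rule exI, safe)
      show "gauge \<gamma>"
        using r(1) U by (auto simp: gauge_def \<gamma>_def)
    next
      fix p
      assume p: "p tagged_division_of {a..b}" and fine: "\<gamma> fine p"
      have pp: "finite p" using p by (rule tagged_division_of_finite)
      have ivl: "\<exists>u v. K = {u..v} \<and> u \<le> v \<and> x \<in> {u..v} \<and> {u..v} \<subseteq> {a..b} \<and> Sup K = v \<and> Inf K = u \<and> measure lborel K = v - u"
        if xK: "(x, K) \<in> p" for x K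
      proof -
        obtain u v where uv: "K = cbox u v" "x \<in> K" "K \<subseteq> {a..b}"
          using tagged_division_ofD(2)[OF p xK] tagged_division_ofD(3)[OF p xK]
            tagged_division_ofD(4)[OF p xK] by blast
        then have "u \<le> v" by auto
        then show ?thesis using uv by (intro exI[of _ u] exI[of _ v]) auto
      qed
      define p1 where "p1 = {z\<in>p. fst z \<in> N}"
      define h where "h z = norm (measure lborel (snd z) *\<^sub>R g (fst z) - (f (Sup (snd z)) - f (Inf (snd z))))" for z
      have p1: "p1 \<subseteq> p" by (auto simp: p1_def)
      have tp1: "p1 tagged_division_of (\<Union>(snd ` p1))"
        using tagged_partial_division_of_Union_self tagged_partial_division_subset p p1
        by (metis tagged_division_of_def)
      have div1: "(snd ` p1) division_of (\<Union>(snd ` p1))"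
        using division_of_tagged_division[OF tp1] .
      have sub: "\<Union>(snd ` p1) \<subseteq> {a..b}" "\<Union>(snd ` p1) \<subseteq> U"
      proof -
        show "\<Union>(snd ` p1) \<subseteq> {a..b}" using p1 tagged_division_ofD(3)[OF p] by force
        show "\<Union>(snd ` p1) \<subseteq> U"
          using fine by (force simp: p1_def fine_def \<gamma>_def split: prod.splits if_splits)
      qed
      have "sum h p1 = (\<Sum>(x,K)\<in>p1. if K = {} then 0 else norm (f (Sup K) - f (Inf K)))"
      proof (rule sum.cong[OF refl], clarify)
        fix x K assume "(x, K) \<in> p1"
        then have "x \<in> N" "(x, K) \<in> p" by (auto simp: p1_def)
        moreover from ivl[OF this(2)] have "K \<noteq> {}" by force
        ultimately show "h (x, K) = (if K = {} then 0 else norm (f (Sup K) - f (Inf K)))"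
          by (simp add: h_def g_def norm_minus_commute)
      qed
      \<comment> \<open>Two tags may share an interval only if it is degenerate, and then its increment vanishes.\<close>
      also have "\<dots> = (\<Sum>K\<in>snd ` p1. if K = {} then 0 else norm (f (Sup K) - f (Inf K)))"
      proof (rule sum.over_tagged_division_lemma[OF tp1])
        fix u v :: real
        assume "box u v = {}"
        then have "v \<le> u" by (simp add: box_real)
        then consider "u = v" | "v < u" by linarith
        then show "(if cbox u v = {} then 0 else norm (f (Sup (cbox u v)) - f (Inf (cbox u v)))) = 0"
          by cases auto
      qed
      also have "\<dots> = (\<Sum>K\<in>snd ` p1. norm (f (Sup K) - f (Inf K)))"
        using division_ofD(3)[OF div1] by (intro sum.cong) auto
      also have "\<dots> < e * (b - a) / 2"
      proof (rule d[OF div1 sub(1)])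
        have "(\<Sum>k\<in>snd ` p1. Sup k - Inf k) = measure lebesgue (\<Union>(snd ` p1))"
          by (rule division_sum_length_eq_measure[OF div1])
        also have "\<dots> \<le> measure lebesgue U"
          using sub(2) Um
          by (intro measure_mono_fmeasurable) (auto simp: fmeasurableD lmeasurable_division[OF div1])
        finally show "(\<Sum>k\<in>snd ` p1. Sup k - Inf k) < d" using U_less by simp
      qed
      finally have h1: "sum h p1 \<le> e * (b - a) / 2" by simp
      have len: "(\<Sum>(x,K)\<in>p. Sup K - Inf K) = b - a"
        using additive_tagged_division_1[OF \<open>a \<le> b\<close> p, of "\<lambda>x. x"] by simp
      have "sum h (p - p1) \<le> (\<Sum>(x,K)\<in>p - p1. e / 2 * (Sup K - Inf K))"
      proof (rule sum_mono, clarify)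
        fix x K
        assume xK: "(x, K) \<in> p" "(x, K) \<notin> p1"
        then have x: "x \<notin> N" by (simp add: p1_def)
        from ivl[OF xK(1)] obtain u v where uv: "K = {u..v}" "u \<le> v" "x \<in> {u..v}"
          "{u..v} \<subseteq> {a..b}" "Sup K = v" "Inf K = u" "measure lborel K = v - u" by blast
        have "K \<subseteq> ball x (r x)" using fine xK x by (fastforce simp: fine_def \<gamma>_def)
        then have "norm (u - x) < r x" "norm (v - x) < r x"
          using uv subsetD[of K "ball x (r x)" u] subsetD[of K "ball x (r x)" v]
          by (auto simp: dist_real_def)
        moreover have "u \<in> {a..b}" "v \<in> {a..b}" "x \<in> {a..b} - N" using uv x by auto
        ultimately have "norm (f u - f x - (u - x) *\<^sub>R f' x) \<le> e / 2 * norm (u - x)"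
            "norm (f v - f x - (v - x) *\<^sub>R f' x) \<le> e / 2 * norm (v - x)"
          using r(2) by blast+
        moreover have "norm ((v - u) *\<^sub>R f' x - (f v - f u)) \<le>
            norm (f u - f x - (u - x) *\<^sub>R f' x) + norm (f v - f x - (v - x) *\<^sub>R f' x)"
        proof -
          have "(v - u) *\<^sub>R f' x - (f v - f u) =
              (f u - f x - (u - x) *\<^sub>R f' x) - (f v - f x - (v - x) *\<^sub>R f' x)"
            by (auto simp: algebra_simps)
          then show ?thesis by (metis norm_triangle_ineq4)
        qed
        ultimately have "norm ((v - u) *\<^sub>R f' x - (f v - f u))
            \<le> e / 2 * norm (u - x) + e / 2 * norm (v - x)" by linarith
        also have "\<dots> = e / 2 * (v - u)" using uv by (auto simp: field_simps)
        finally show "h (x, K) \<le> e / 2 * (Sup K - Inf K)"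
          using uv x by (simp add: h_def g_def norm_minus_commute)
      qed
      also have "\<dots> \<le> (\<Sum>(x,K)\<in>p. e / 2 * (Sup K - Inf K))"
        using ivl \<open>e > 0\<close> by (intro sum_mono2[OF pp]) (force simp: p1_def)+
      also have "\<dots> = e * (b - a) / 2"
        by (simp add: split_def len[unfolded split_def, symmetric] sum_distrib_left sum_divide_distrib)
      finally have "sum h p \<le> e * (b - a)"
        using h1 sum.subset_diff[OF p1 pp, of h] by linarith
      moreover have "(\<Sum>(x, k)\<in>p. measure lborel k *\<^sub>R g x) - (f b - f a) =
          (\<Sum>z\<in>p. measure lborel (snd z) *\<^sub>R g (fst z) - (f (Sup (snd z)) - f (Inf (snd z))))"
        using additive_tagged_division_1[OF \<open>a \<le> b\<close> p, of f]
        by (simp add: split_def sum_subtractf)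
      ultimately show "norm ((\<Sum>(x, k)\<in>p. measure lborel k *\<^sub>R g x) - (f b - f a)) \<le> e * measure lborel {a..b}"
        using norm_sum[of "\<lambda>z. measure lborel (snd z) *\<^sub>R g (fst z) - (f (Sup (snd z)) - f (Inf (snd z)))" p] \<open>a < b\<close>
        unfolding h_def by simp
    qed
  qed
  then show ?thesis
    by (rule has_integral_spike[OF N, rotated]) (simp add: g_def)
qed

text \<open>
  The indefinite integral of \<open>f'\<close> is \<open>f\<close>, so \<open>f'\<close> is absolutely integrable where \<open>f\<close> has bounded
  variation. On an interval shorter than the \<open>\<delta>\<close> belonging to \<open>\<epsilon> = 1\<close> the variation of \<open>f\<close> is at
  most \<open>1\<close>, and finitely many such intervals cover \<open>{a..b}\<close>.
\<close>

lemma absolutely_integrable_abs_continuous: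
  fixes f :: "real \<Rightarrow> 'a::euclidean_space"
  assumes ac: "abs_continuous_on_ivl a b f" and "a \<le> b" and N: "negligible N"
    and deriv: "\<And>x. x \<in> {a..b} - N \<Longrightarrow> (f has_vector_derivative f' x) (at x within {a..b})"
  shows "f' absolutely_integrable_on {a..b}"
proof -
  have int: "(f' has_integral (f d - f c)) {c..d}" if "a \<le> c" "c \<le> d" "d \<le> b" for c d
  proof (rule has_integral_abs_continuous[OF _ \<open>c \<le> d\<close> N])
    show "abs_continuous_on_ivl c d f" using ac that by (auto intro: abs_continuous_on_subivl)
    show "(f has_vector_derivative f' x) (at x within {c..d})" if "x \<in> {c..d} - N" for x
      using deriv[of x] that \<open>a \<le> c\<close> \<open>d \<le> b\<close>
      by (meson Diff_iff atLeastAtMost_iff atLeastatMost_subset_iff has_vector_derivative_within_subset order_trans)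
  qed
  obtain \<delta> where "\<delta> > 0" and \<delta>:
    "\<And>D. D division_of (\<Union>D) \<Longrightarrow> \<Union>D \<subseteq> {a..b} \<Longrightarrow> (\<Sum>k\<in>D. Sup k - Inf k) < \<delta> \<Longrightarrow>
        (\<Sum>k\<in>D. norm (f (Sup k) - f (Inf k))) < 1"
    using ac zero_less_one unfolding abs_continuous_on_ivl_def by meson
  have short: "f' absolutely_integrable_on {c..d}" if cd: "a \<le> c" "c \<le> d" "d \<le> b" "d - c < \<delta>" for c d
    unfolding cbox_interval[symmetric]
  proof (rule bounded_variation_absolutely_integrable_interval)
    show "f' integrable_on cbox c d" using int[OF cd(1-3)] by (auto simp: integrable_on_def)
    fix D assume D: "D division_of cbox c d"
    have "(\<Sum>K\<in>D. norm (integral K f')) = (\<Sum>K\<in>D. norm (f (Sup K) - f (Inf K)))"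
    proof (rule sum.cong[OF refl])
      fix K assume "K \<in> D"
      then obtain u v where uv: "K = cbox u v" "K \<noteq> {}" "K \<subseteq> cbox c d"
        using division_ofD(2-4)[OF D] by metis
      then have "u \<le> v" "c \<le> u" "v \<le> d" by auto
      then have "integral K f' = f v - f u" using int[of u v] cd uv by (auto intro: integral_unique)
      then show "norm (integral K f') = norm (f (Sup K) - f (Inf K))" using uv \<open>u \<le> v\<close> by simp
    qed
    also have "\<dots> < 1"
    proof (rule \<delta>)
      have "\<Union>D = cbox c d" using D by blast
      then show "D division_of \<Union>D" "\<Union>D \<subseteq> {a..b}" using D cd by auto
      show "(\<Sum>k\<in>D. Sup k - Inf k) < \<delta>"
        using division_sum_length_eq_measure[OF D] cd by simp
    qed
    finally show "(\<Sum>K\<in>D. norm (integral K f')) \<le> 1" by simp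
  qed
  \<comment> \<open>The length \<open>\<delta>/2\<close> of the pieces is strictly below \<open>\<delta>\<close>.\<close>
  have "f' absolutely_integrable_on {a..min b (a + real n * (\<delta>/2))}" for n
  proof (induction n)
    case 0
    then show ?case using short[of a a] \<open>a \<le> b\<close> \<open>\<delta> > 0\<close> by simp
  next
    case (Suc n)
    let ?c = "min b (a + real n * (\<delta>/2))" and ?d = "min b (a + real (Suc n) * (\<delta>/2))"
    have c: "a \<le> ?c" "?c \<le> ?d" "?d \<le> b" "?d - ?c < \<delta>"
    proof -
      have "a + real (Suc n) * (\<delta>/2) = (a + real n * (\<delta>/2)) + \<delta>/2" by (simp add: algebra_simps)
      moreover have "0 \<le> real n * (\<delta>/2)" using \<open>\<delta> > 0\<close> by simp
      ultimately show "a \<le> ?c" "?c \<le> ?d" "?d \<le> b" "?d - ?c < \<delta>"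
        using \<open>\<delta> > 0\<close> \<open>a \<le> b\<close> by linarith+
    qed
    have "f' absolutely_integrable_on ({a..?c} \<union> {?c..?d})"
      using Suc short[OF c] by (rule absolutely_integrable_Un)
    moreover have "{a..?c} \<union> {?c..?d} = {a..?d}" using c(1,2) by (rule ivl_disj_un_two_touch)
    ultimately show ?case by simp
  qed
  moreover obtain n :: nat where "(b - a) / (\<delta>/2) < real n" using reals_Archimedean2 by blast
  then have "min b (a + real n * (\<delta>/2)) = b" using \<open>\<delta> > 0\<close> by (simp add: field_simps)
  ultimately show ?thesis by metis
qed

section \<open>The isoperimetric inequality for polygons\<close>

text \<open>
  The number \<open>2 cos (\<pi>/N)\<close> is the largest eigenvalue of the path graph on the \<open>N - 1\<close> inner
  vertices. Its eigenvector \<open>s\<^sub>k = sin (k \<pi>/N)\<close> is positive, so each product can be estimated by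
  the inequality of means with weight \<open>s\<^sub>k\<^sub>+\<^sub>1 / s\<^sub>k\<close>. The weights collected at each vertex then sum to
  the eigenvalue, because \<open>s\<^sub>k\<^sub>+\<^sub>1 + s\<^sub>k\<^sub>-\<^sub>1 = 2 cos (\<pi>/N) s\<^sub>k\<close>.
\<close>

lemma dirichlet_path_inequality:
  fixes u :: "nat \<Rightarrow> complex"
  assumes N: "N \<ge> 2" and u: "u 0 = 0" "u N = 0"
  shows "(\<Sum>k<N. Re (cnj (u k) * u (Suc k))) \<le> cos (pi / N) * (\<Sum>k<N. (cmod (u k))\<^sup>2)"
proof -
  define \<theta> where "\<theta> = pi / N"
  define s where "s k = sin (real k * \<theta>)" for k
  have s_pos: "s k > 0" if "0 < k" "k < N" for k
    unfolding s_def \<theta>_def using that by (intro sin_gt_zero) (auto simp: field_simps)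
  have s_add: "s (Suc k) + s (k - 1) = 2 * cos \<theta> * s k" if "0 < k" for k
  proof -
    obtain j where j: "k = Suc j" using \<open>0 < k\<close> by (cases k) auto
    have "s (Suc k) = sin (real k * \<theta> + \<theta>)" "s (k - 1) = sin (real k * \<theta> - \<theta>)"
      by (simp_all add: s_def j algebra_simps)
    then show ?thesis by (simp add: s_def sin_add sin_diff)
  qed
  have step: "2 * Re (cnj (u k) * u (Suc k)) \<le>
      s (Suc k) / s k * (cmod (u k))\<^sup>2 + s k / s (Suc k) * (cmod (u (Suc k)))\<^sup>2"
    if k: "k < N" for k
  proof (cases "k = 0 \<or> Suc k = N")
    \<comment> \<open>At the two ends the left side is \<open>0\<close>, and division by the vanishing sine gives \<open>0\<close> as well.\<close>
    case True
    then show ?thesis using u by (auto simp: s_def \<theta>_def)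
  next
    case False
    then have p: "s k > 0" "s (Suc k) > 0" using k by (auto intro: s_pos)
    define q where "q = sqrt (s (Suc k) / s k)"
    have q: "q > 0" "q\<^sup>2 = s (Suc k) / s k" "(1/q)\<^sup>2 = s k / s (Suc k)"
      using p by (auto simp: q_def real_sqrt_divide power_divide)
    have "Re (cnj (u k) * u (Suc k)) \<le> cmod (u k) * cmod (u (Suc k))"
      by (metis complex_Re_le_cmod complex_mod_cnj norm_mult)
    moreover have "2 * (cmod (u k) * cmod (u (Suc k))) \<le> q\<^sup>2 * (cmod (u k))\<^sup>2 + (1/q)\<^sup>2 * (cmod (u (Suc k)))\<^sup>2"
      using sum_squares_bound[of "q * cmod (u k)" "cmod (u (Suc k)) / q"] q(1)
      by (simp add: power_mult_distrib power_divide)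
    ultimately show ?thesis using q by simp
  qed
  obtain M where M: "N = Suc M" "M \<ge> 1" using N by (cases N) auto
  have "2 * (\<Sum>k<N. Re (cnj (u k) * u (Suc k)))
      \<le> (\<Sum>k<N. s (Suc k) / s k * (cmod (u k))\<^sup>2 + s k / s (Suc k) * (cmod (u (Suc k)))\<^sup>2)"
    unfolding sum_distrib_left by (intro sum_mono step) simp
  also have "\<dots> = (\<Sum>k<N. s (Suc k) / s k * (cmod (u k))\<^sup>2)
      + (\<Sum>k<N. s k / s (Suc k) * (cmod (u (Suc k)))\<^sup>2)"
    by (rule sum.distrib)
  also have "(\<Sum>k<N. s k / s (Suc k) * (cmod (u (Suc k)))\<^sup>2)
      = (\<Sum>k<N. s (k - 1) / s k * (cmod (u k))\<^sup>2)"
  proof -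
    have "(\<Sum>k<N. s k / s (Suc k) * (cmod (u (Suc k)))\<^sup>2)
       = (\<Sum>k<Suc N. s (k - 1) / s k * (cmod (u k))\<^sup>2)"
      by (subst sum.lessThan_Suc_shift) (simp add: s_def)
    then show ?thesis using u by simp
  qed
  also have "(\<Sum>k<N. s (Suc k) / s k * (cmod (u k))\<^sup>2) + (\<Sum>k<N. s (k - 1) / s k * (cmod (u k))\<^sup>2)
      = (\<Sum>k<N. 2 * cos \<theta> * (cmod (u k))\<^sup>2)"
    unfolding sum.distrib[symmetric]
  proof (rule sum.cong[OF refl])
    fix k assume "k \<in> {..<N}"
    show "s (Suc k) / s k * (cmod (u k))\<^sup>2 + s (k - 1) / s k * (cmod (u k))\<^sup>2 = 2 * cos \<theta> * (cmod (u k))\<^sup>2"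
    proof (cases "k = 0")
      case False
      then have "s k > 0" using \<open>k \<in> {..<N}\<close> s_pos by auto
      then show ?thesis using s_add[of k] False
        by (simp add: add_divide_distrib[symmetric] distrib_right[symmetric])
    qed (simp add: u)
  qed
  finally show ?thesis by (simp add: sum_distrib_left[symmetric] \<theta>_def mult.assoc)
qed

text \<open>
  Multiplication of the \<open>k\<close>-th vertex by \<open>e\<^sup>-\<^sup>i\<^sup>k\<^sup>\<theta>\<close>, where \<open>\<theta> = \<pi>/N\<close>, absorbs the area term into the
  scalar product of consecutive vertices: \<open>cot \<theta> \<cdot> Re w + Im w = Re (e\<^sup>-\<^sup>i\<^sup>\<theta> w) / sin \<theta>\<close>. What is left is
  the eigenvalue estimate above.
\<close>

lemma polygon_isoperimetric_complex:
  fixes z :: "nat \<Rightarrow> complex"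
  assumes N: "N \<ge> 2" and z: "z 0 = 0" "z N = 0"
  shows "2 * (\<Sum>k<N. Im (cnj (z k) * z (Suc k))) \<le> cot (pi / N) * (\<Sum>k<N. (cmod (z (Suc k) - z k))\<^sup>2)"
proof -
  define \<theta> where "\<theta> = pi / N"
  have sp: "sin \<theta> > 0"
    unfolding \<theta>_def using N by (intro sin_gt_zero) (auto simp: field_simps)
  define u where "u k = cis (- (real k * \<theta>)) * z k" for k
  have cm: "cmod (u k) = cmod (z k)" for k by (simp add: u_def norm_mult)
  have tw: "Re (cnj (u k) * u (Suc k)) = cos \<theta> * Re (cnj (z k) * z (Suc k)) + sin \<theta> * Im (cnj (z k) * z (Suc k))" for k
  proof -
    have "cnj (u k) * u (Suc k) = (cis (real k * \<theta>) * cis (- (real (Suc k) * \<theta>))) * (cnj (z k) * z (Suc k))"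
      by (simp add: u_def cis_cnj)
    also have "cis (real k * \<theta>) * cis (- (real (Suc k) * \<theta>)) = cis (-\<theta>)"
      by (simp add: cis_mult algebra_simps)
    finally show ?thesis by simp
  qed
  have sq: "(cmod (z (Suc k) - z k))\<^sup>2 = (cmod (z k))\<^sup>2 + (cmod (z (Suc k)))\<^sup>2 - 2 * Re (cnj (z k) * z (Suc k))" for k
    unfolding cmod_power2 by (simp add: power2_eq_square algebra_simps)
  have shift: "(\<Sum>k<N. (cmod (z (Suc k)))\<^sup>2) = (\<Sum>k<N. (cmod (z k))\<^sup>2)"
    using sum.lessThan_Suc_shift[of "\<lambda>k. (cmod (z k))\<^sup>2" N] z by simp
  define R where "R = (\<Sum>k<N. Re (cnj (z k) * z (Suc k)))"
  define I where "I = (\<Sum>k<N. Im (cnj (z k) * z (Suc k)))"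
  define Q where "Q = (\<Sum>k<N. (cmod (z k))\<^sup>2)"
  have "(\<Sum>k<N. Re (cnj (u k) * u (Suc k))) \<le> cos \<theta> * (\<Sum>k<N. (cmod (u k))\<^sup>2)"
    unfolding \<theta>_def by (rule dirichlet_path_inequality[OF N]) (simp_all add: u_def z)
  then have "cos \<theta> * R + sin \<theta> * I \<le> cos \<theta> * Q"
    unfolding tw cm sum.distrib sum_distrib_left[symmetric] R_def I_def Q_def .
  moreover have "(\<Sum>k<N. (cmod (z (Suc k) - z k))\<^sup>2) = 2 * Q - 2 * R"
    unfolding sq by (simp only: sum_subtractf sum.distrib shift sum_distrib_left[symmetric] R_def Q_def)
  ultimately have "2 * I * sin \<theta> \<le> cos \<theta> * (\<Sum>k<N. (cmod (z (Suc k) - z k))\<^sup>2)"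
    by (simp only: right_diff_distrib) (simp add: algebra_simps)
  then show ?thesis
    using sp unfolding I_def[symmetric] \<theta>_def[symmetric] by (simp add: cot_def field_simps)
qed

text \<open>
  Up to sign, the standard symplectic form of \<open>\<real>\<^sup>2\<^sup>n\<close>; the group law adds twice its value to the
  \<open>t\<close>-coordinates, and a horizontal curve satisfies \<open>t' = 2 heis_form z z'\<close>.
\<close>

definition heis_form :: "(real ^ 'n::finite) \<times> (real ^ 'n) \<Rightarrow> (real ^ 'n) \<times> (real ^ 'n) \<Rightarrow> real" where
  "heis_form p q = fst q \<bullet> snd p - fst p \<bullet> snd q"

text \<open>
  The form is the scalar product after a rotation, which gives linearity and the Cauchy-Schwarz bound.
\<close>

lemma heis_form_eq_inner: "heis_form p q = (snd p, - fst p) \<bullet> q"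
  by (simp add: heis_form_def inner_prod_def inner_commute)

lemma heis_form_le: "\<bar>heis_form p q\<bar> \<le> norm p * norm q"
proof -
  have "norm (snd p, - fst p) = norm p"
    by (simp add: norm_prod_def add.commute)
  then show ?thesis unfolding heis_form_eq_inner by (metis Cauchy_Schwarz_ineq2)
qed

lemma heis_form_self [simp]: "heis_form p p = 0"
  by (simp add: heis_form_def inner_commute)

lemma heis_form_distribs:
  "heis_form (p + p') q = heis_form p q + heis_form p' q"
  "heis_form (p - p') q = heis_form p q - heis_form p' q"
  "heis_form p (q + q') = heis_form p q + heis_form p q'"
  "heis_form p (q - q') = heis_form p q - heis_form p q'"
  by (simp_all add: heis_form_def inner_simps)

lemma heis_form_swap: "heis_form q p = - heis_form p q"
  by (simp add: heis_form_def inner_commute)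

lemma heis_form_uminus: "heis_form (- p) q = - heis_form p q" "heis_form p (- q) = - heis_form p q"
  by (simp_all add: heis_form_def)

lemma bounded_linear_heis_form: "bounded_linear (heis_form p)"
  unfolding heis_form_eq_inner[abs_def] by (rule bounded_linear_inner_right)

lemma heis_form_sum: "heis_form (x, y) (x', y') = (\<Sum>i\<in>UNIV. x' $ i * y $ i - x $ i * y' $ i)"
  by (simp add: heis_form_def inner_vec_def sum_subtractf)

lemma heis_mult_eq:
  "heis_mult (x, y, t) (x', y', t') = (x + x', y + y', t + t' + 2 * heis_form (x, y) (x', y'))"
  by (simp add: heis_mult_def heis_form_sum)

text \<open>
  The symplectic area of a closed polygon is the sum of the areas of its projections to the coordinate
  planes, and the squared edge lengths add up in the same way. The inequality in the plane therefore
  gives the inequality in every dimension with the same constant.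
\<close>

lemma polygon_isoperimetric:
  fixes p :: "nat \<Rightarrow> (real ^ 'n) \<times> (real ^ 'n)"
  assumes N: "N \<ge> 2" and closed: "p N = p 0"
  shows "2 * (\<Sum>k<N. heis_form (p k) (p (Suc k))) \<le> cot (pi / N) * (\<Sum>k<N. (norm (p (Suc k) - p k))\<^sup>2)"
proof -
  \<comment> \<open>The order \<open>(y, x)\<close> of the parts makes \<open>heis_form\<close> the imaginary part of \<open>cnj z * w\<close>.\<close>
  define z where "z i k = Complex (snd (p k - p 0) $ i) (fst (p k - p 0) $ i)" for i k
  have "(\<Sum>k<N. heis_form (p k) (p (Suc k)))
      = (\<Sum>k<N. heis_form (p k - p 0) (p (Suc k) - p 0)) + (\<Sum>k<N. heis_form (p 0) (p (Suc k)) - heis_form (p 0) (p k))"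
    unfolding sum.distrib[symmetric]
    by (rule sum.cong) (auto simp: heis_form_distribs heis_form_swap[of _ "p 0"])
  also have "(\<Sum>k<N. heis_form (p 0) (p (Suc k)) - heis_form (p 0) (p k)) = 0"
    by (subst sum_lessThan_telescope) (simp add: closed)
  also have "(\<Sum>k<N. heis_form (p k - p 0) (p (Suc k) - p 0))
      = (\<Sum>i\<in>UNIV. \<Sum>k<N. Im (cnj (z i k) * z i (Suc k)))"
    by (subst sum.swap) (simp add: heis_form_def inner_vec_def sum_subtractf[symmetric] z_def algebra_simps)
  finally have form: "(\<Sum>k<N. heis_form (p k) (p (Suc k))) = (\<Sum>i\<in>UNIV. \<Sum>k<N. Im (cnj (z i k) * z i (Suc k)))"
    by simp
  have "(norm q)\<^sup>2 = (\<Sum>i\<in>UNIV. (fst q $ i)\<^sup>2 + (snd q $ i)\<^sup>2)" for q :: "(real ^ 'n) \<times> (real ^ 'n)"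
    by (simp add: norm_prod_def norm_vec_def L2_set_def sum_nonneg sum.distrib)
  then have len: "(\<Sum>k<N. (norm (p (Suc k) - p k))\<^sup>2) = (\<Sum>i\<in>UNIV. \<Sum>k<N. (cmod (z i (Suc k) - z i k))\<^sup>2)"
    by (subst sum.swap) (simp add: z_def cmod_power2 add.commute)
  show ?thesis
    unfolding form len sum_distrib_left[of _ _ UNIV]
    by (intro sum_mono polygon_isoperimetric_complex[OF N])
      (simp_all add: z_def closed zero_complex.code)
qed

section \<open>The isoperimetric inequality for horizontal curves\<close>

text \<open>
  Replacing a horizontal curve by the lift of a chord of its projection changes the rise in \<open>t\<close> only to
  second order in the length: \<open>t' - 2 heis_form (z a) z'\<close> equals \<open>2 heis_form (z - z a) z'\<close>, and
  \<open>z - z a\<close> is bounded by the length.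
\<close>

lemma lift_chord_deviation:
  fixes z :: "real \<Rightarrow> (real ^ 'n) \<times> (real ^ 'n)" and t :: "real \<Rightarrow> real"
  assumes "a \<le> b" and N: "negligible N"
    and z: "\<And>c. c \<in> {a..b} \<Longrightarrow> (z' has_integral z c - z a) {a..c}"
    and t: "(t' has_integral t b - t a) {a..b}"
    and m: "(\<lambda>s. norm (z' s)) integrable_on {a..b}"
    and horizontal: "\<And>s. s \<in> {a..b} - N \<Longrightarrow> t' s = 2 * heis_form (z s) (z' s)"
  shows "\<bar>t b - t a - 2 * heis_form (z a) (z b)\<bar> \<le> 2 * (integral {a..b} (\<lambda>s. norm (z' s)))\<^sup>2"
proof -
  define l where "l = integral {a..b} (\<lambda>s. norm (z' s))"
  define F where "F s = (if s \<in> N then 0 else t' s - 2 * heis_form (z a) (z' s))" for s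
  have "((\<lambda>s. heis_form (z a) (z' s)) has_integral heis_form (z a) (z b - z a)) {a..b}"
    using has_integral_linear[OF z[of b] bounded_linear_heis_form] \<open>a \<le> b\<close> by (simp add: o_def)
  then have F': "((\<lambda>s. t' s - 2 * heis_form (z a) (z' s)) has_integral (t b - t a - 2 * heis_form (z a) (z b - z a))) {a..b}"
    by (intro has_integral_diff t has_integral_mult_right)
  have F: "(F has_integral (t b - t a - 2 * heis_form (z a) (z b))) {a..b}"
    using has_integral_spike[OF N _ F', of F] by (simp add: F_def heis_form_distribs)
  have dist: "norm (z s - z a) \<le> l" if s: "s \<in> {a..b}" for s
  proof -
    have ms: "(\<lambda>s. norm (z' s)) integrable_on {a..s}"
      using m s by (auto intro: integrable_subinterval_real)
    have "norm (z s - z a) = norm (integral {a..s} z')" using z[OF s] by (simp add: integral_unique)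
    also have "\<dots> \<le> integral {a..s} (\<lambda>s. norm (z' s))"
      using z[OF s] ms by (intro integral_norm_bound_integral) auto
    also have "\<dots> \<le> l"
      unfolding l_def using s m ms by (intro integral_subset_le) auto
    finally show ?thesis .
  qed
  have "l \<ge> 0" using dist[of a] \<open>a \<le> b\<close> by simp
  have "norm (integral {a..b} F) \<le> integral {a..b} (\<lambda>s. 2 * l * norm (z' s))"
  proof (rule integral_norm_bound_integral)
    show "F integrable_on {a..b}" using F by blast
    show "(\<lambda>s. 2 * l * norm (z' s)) integrable_on {a..b}"
      using integrable_on_cmult_left[OF m, of "2 * l"] by simp
    fix s assume s: "s \<in> {a..b}"
    show "norm (F s) \<le> 2 * l * norm (z' s)"
    proof (cases "s \<in> N")
      case False
      have "F s = 2 * heis_form (z s - z a) (z' s)"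
        using horizontal[of s] s False by (simp add: F_def heis_form_distribs)
      moreover have "\<bar>heis_form (z s - z a) (z' s)\<bar> \<le> l * norm (z' s)"
        using heis_form_le[of "z s - z a" "z' s"] mult_right_mono[OF dist[OF s] norm_ge_zero[of "z' s"]]
        by linarith
      ultimately show ?thesis by simp
    qed (use \<open>l \<ge> 0\<close> in \<open>simp add: F_def\<close>)
  qed
  then show ?thesis
    using integral_unique[OF F] by (simp add: l_def power2_eq_square)
qed

lemma cot_le_inverse:
  assumes "0 < \<theta>" "\<theta> < pi / 2"
  shows "cot \<theta> \<le> 1 / \<theta>"
proof -
  have "\<theta> \<le> tan \<theta>"
    using abs_tan_ge[of \<theta>] tan_pos_pi2_le[of \<theta>] assms by simp
  then have "1 / tan \<theta> \<le> 1 / \<theta>" using assms by (simp add: frac_le)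
  then show ?thesis by (simp add: cot_def tan_def)
qed

text \<open>
  Cut the curve into \<open>n\<close> arcs of equal length. The rise in \<open>t\<close> is four times the symplectic area of
  the inscribed polygon up to an error of \<open>2 L\<^sup>2 / n\<close>, and the polygon has edges of length at most
  \<open>L / n\<close>, so its contribution is at most \<open>cot (\<pi>/n) L\<^sup>2 / n \<le> L\<^sup>2 / \<pi>\<close>. Then \<open>n\<close> tends to infinity.
\<close>

lemma isoperimetric_lift:
  fixes z :: "real \<Rightarrow> (real ^ 'n) \<times> (real ^ 'n)" and t :: "real \<Rightarrow> real"
  assumes "0 \<le> S" and N: "negligible N"
    and z: "\<And>c d. 0 \<le> c \<Longrightarrow> c \<le> d \<Longrightarrow> d \<le> S \<Longrightarrow> (z' has_integral z d - z c) {c..d}"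
    and t: "\<And>c d. 0 \<le> c \<Longrightarrow> c \<le> d \<Longrightarrow> d \<le> S \<Longrightarrow> (t' has_integral t d - t c) {c..d}"
    and m: "(\<lambda>s. norm (z' s)) integrable_on {0..S}"
    and horizontal: "\<And>s. s \<in> {0..S} - N \<Longrightarrow> t' s = 2 * heis_form (z s) (z' s)"
    and closed: "z S = z 0"
  shows "pi * (t S - t 0) \<le> (integral {0..S} (\<lambda>s. norm (z' s)))\<^sup>2"
proof -
  define L where "L = integral {0..S} (\<lambda>s. norm (z' s))"
  define F where "F s = integral {0..s} (\<lambda>s. norm (z' s))" for s
  have m_sub: "(\<lambda>s. norm (z' s)) integrable_on {c..d}" if "0 \<le> c" "d \<le> S" for c d
    using m that by (auto intro: integrable_subinterval_real)
  have F_diff: "integral {c..d} (\<lambda>s. norm (z' s)) = F d - F c" if "0 \<le> c" "c \<le> d" "d \<le> S" for c d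
    using Henstock_Kurzweil_Integration.integral_combine[OF that(1,2) m_sub[OF order_refl that(3)]] by (simp add: F_def)
  have F_mono: "F c \<le> F d" if "0 \<le> c" "c \<le> d" "d \<le> S" for c d
    using F_diff[OF that] integral_nonneg[OF m_sub, of c d] that by simp
  have F0: "F 0 = 0" "F S = L" by (simp_all add: F_def L_def)
  have "L \<ge> 0" using F_mono[of 0 S] F0 \<open>0 \<le> S\<close> by simp
  have chord: "t d - t c \<le> 2 * heis_form (z c) (z d) + 2 * (F d - F c)\<^sup>2"
    if cd: "0 \<le> c" "c \<le> d" "d \<le> S" for c d
  proof -
    have "\<bar>t d - t c - 2 * heis_form (z c) (z d)\<bar> \<le> 2 * (integral {c..d} (\<lambda>s. norm (z' s)))\<^sup>2"
      using cd by (intro lift_chord_deviation[OF \<open>c \<le> d\<close> N, of z' z t']) (auto intro!: z t m_sub horizontal)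
    then show ?thesis using F_diff[OF cd] by simp
  qed
  have z_le: "norm (z d - z c) \<le> F d - F c" if cd: "0 \<le> c" "c \<le> d" "d \<le> S" for c d
  proof -
    have "norm (integral {c..d} z') \<le> integral {c..d} (\<lambda>s. norm (z' s))"
      using z[OF cd] m_sub[of c d] cd by (intro integral_norm_bound_integral) auto
    then show ?thesis using integral_unique[OF z[OF cd]] F_diff[OF cd] by simp
  qed
  have bound: "pi * (t S - t 0) \<le> L\<^sup>2 + 2 * pi * L\<^sup>2 / n" if "n \<ge> 3" for n :: nat
  proof (cases "L = 0")
    case True
    then show ?thesis using chord[of 0 S] \<open>0 \<le> S\<close> closed F0 by (simp add: mult_nonneg_nonpos)
  next
    case False
    then have "L > 0" using \<open>L \<ge> 0\<close> by simp
    have "\<exists>s. 0 \<le> s \<and> s \<le> S \<and> F s = real k * L / n" if "k \<le> n" for k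
    proof -
      have "F 0 \<le> real k * L / n" "real k * L / n \<le> F S"
        using F0 \<open>L > 0\<close> that \<open>n \<ge> 3\<close> by (auto simp: field_simps)
      moreover have "continuous_on {0..S} F"
        unfolding F_def using m by (rule indefinite_integral_continuous_1)
      ultimately show ?thesis using IVT'[of F 0 _ S] \<open>0 \<le> S\<close> by blast
    qed
    then obtain \<sigma> where \<sigma>: "\<And>k. k \<le> n \<Longrightarrow> 0 \<le> \<sigma> k \<and> \<sigma> k \<le> S \<and> F (\<sigma> k) = real k * L / n"
      by metis
    \<comment> \<open>The curve may rest at its ends, so the intermediate values need not hit \<open>0\<close> and \<open>S\<close> themselves.\<close>
    define s where "s k = (if k = 0 then 0 else if k = n then S else \<sigma> k)" for k
    have s: "0 \<le> s k" "s k \<le> S" "F (s k) = real k * L / n" if "k \<le> n" for k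
      using \<sigma>[OF that] F0 \<open>0 \<le> S\<close> \<open>n \<ge> 3\<close> by (auto simp: s_def)
    have diff: "F (s (Suc k)) - F (s k) = L / n" if "k < n" for k
      using s(3)[of k] s(3)[of "Suc k"] that by (simp add: field_simps)
    have mono: "s k \<le> s (Suc k)" if "k < n" for k
    proof (rule ccontr)
      assume "\<not> ?thesis"
      then have "F (s (Suc k)) \<le> F (s k)" using s[of k] s[of "Suc k"] that by (intro F_mono) auto
      moreover have "L / n > 0" using \<open>L > 0\<close> \<open>n \<ge> 3\<close> by simp
      ultimately show False using diff[OF that] by linarith
    qed
    have "t S - t 0 = (\<Sum>k<n. t (s (Suc k)) - t (s k))"
      using sum_lessThan_telescope[of "\<lambda>k. t (s k)" n] \<open>n \<ge> 3\<close> by (simp add: s_def)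
    also have "\<dots> \<le> (\<Sum>k<n. 2 * heis_form (z (s k)) (z (s (Suc k))) + 2 * (L / n)\<^sup>2)"
    proof (rule sum_mono)
      fix k assume "k \<in> {..<n}"
      then have k: "k < n" by simp
      show "t (s (Suc k)) - t (s k) \<le> 2 * heis_form (z (s k)) (z (s (Suc k))) + 2 * (L / n)\<^sup>2"
        using chord[of "s k" "s (Suc k)"] s[of k] s[of "Suc k"] mono[OF k] diff[OF k] k by simp
    qed
    also have "\<dots> = 2 * (\<Sum>k<n. heis_form (z (s k)) (z (s (Suc k)))) + 2 * L\<^sup>2 / n"
      using \<open>n \<ge> 3\<close> by (simp add: sum.distrib sum_distrib_left[symmetric] power2_eq_square)
    also have "2 * (\<Sum>k<n. heis_form (z (s k)) (z (s (Suc k))))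
        \<le> cot (pi / n) * (\<Sum>k<n. (norm (z (s (Suc k)) - z (s k)))\<^sup>2)"
      using \<open>n \<ge> 3\<close> closed by (intro polygon_isoperimetric) (auto simp: s_def)
    also have "\<dots> \<le> (n / pi) * (\<Sum>k<n. (L / n)\<^sup>2)"
    proof (rule mult_mono)
      show "cot (pi / n) \<le> n / pi"
        using cot_le_inverse[of "pi / n"] \<open>n \<ge> 3\<close> by (simp add: field_simps)
      show "(\<Sum>k<n. (norm (z (s (Suc k)) - z (s k)))\<^sup>2) \<le> (\<Sum>k<n. (L / n)\<^sup>2)"
      proof (intro sum_mono power_mono)
        fix k assume "k \<in> {..<n}"
        then have k: "k < n" by simp
        show "norm (z (s (Suc k)) - z (s k)) \<le> L / n"
          using z_le[of "s k" "s (Suc k)"] s[of k] s[of "Suc k"] mono[OF k] diff[OF k] k by simp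
      qed simp
    qed (auto intro: sum_nonneg)
    also have "(n / pi) * (\<Sum>k<n. (L / n)\<^sup>2) = L\<^sup>2 / pi"
      using \<open>n \<ge> 3\<close> by (simp add: power2_eq_square)
    finally have "t S - t 0 \<le> L\<^sup>2 / pi + 2 * L\<^sup>2 / n" by simp
    then have "pi * (t S - t 0) \<le> pi * (L\<^sup>2 / pi + 2 * L\<^sup>2 / n)" by (intro mult_left_mono) auto
    then show ?thesis by (simp add: distrib_left mult_ac)
  qed
  have "(\<lambda>n. L\<^sup>2 + 2 * pi * L\<^sup>2 / real n) \<longlonglongrightarrow> L\<^sup>2 + 0"
    by (intro tendsto_intros lim_const_over_n)
  then have "pi * (t S - t 0) \<le> L\<^sup>2"
    using bound by (intro LIMSEQ_le_const[of _ "L\<^sup>2"]) auto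
  then show ?thesis by (simp add: L_def)
qed

lemma horizontal_curve_velocity:
  fixes \<Gamma> :: "real \<Rightarrow> 'n::finite heis"
  assumes "horizontal_curve S \<Gamma>"
  obtains N \<Gamma>' where "negligible N"
    "\<And>s. s \<in> {0..S} - N \<Longrightarrow> (\<Gamma> has_vector_derivative \<Gamma>' s) (at s within {0..S})"
    "\<And>s. s \<in> {0..S} - N \<Longrightarrow> \<Gamma>' s \<in> horizontal_space (\<Gamma> s)"
proof -
  let ?P = "\<lambda>s v. v \<in> horizontal_space (\<Gamma> s) \<and> (\<Gamma> has_vector_derivative v) (at s within {0..S})"
  have "AE s in lebesgue_on {0..S}. \<exists>v. ?P s v"
    using assms unfolding horizontal_curve_def by (auto simp: Bex_def)
  then have "AE s in lebesgue. s \<in> {0..S} \<longrightarrow> (\<exists>v. ?P s v)"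
    by (subst (asm) AE_restrict_space_iff) auto
  then obtain N where "N \<in> null_sets lebesgue"
      "{s \<in> space lebesgue. \<not> (s \<in> {0..S} \<longrightarrow> (\<exists>v. ?P s v))} \<subseteq> N"
    unfolding eventually_ae_filter by blast
  then have N: "N \<in> null_sets lebesgue" "\<And>s. s \<in> {0..S} - N \<Longrightarrow> \<exists>v. ?P s v"
    by auto
  then show ?thesis
    using that[of N "\<lambda>s. SOME v. ?P s v"] someI_ex[OF N(2)] by (simp add: negligible_iff_null_sets)
qed

text \<open>
  A curve between two points of one fibre has a closed projection. Its velocity, which exists and is
  horizontal off a null set, integrates to the increments of projection and height because the curve is
  absolutely continuous.
\<close>

lemma vertical_gap_le_length:
  fixes \<Gamma> :: "real \<Rightarrow> 'n::finite heis"
  assumes con: "connects S \<Gamma> (x, y, t1) (x, y, t2)"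
  shows "pi * (t2 - t1) \<le> (heis_length S \<Gamma>)\<^sup>2"
proof -
  have S: "0 < S" and hor: "horizontal_curve S \<Gamma>" and ends: "\<Gamma> 0 = (x, y, t1)" "\<Gamma> S = (x, y, t2)"
    using con by (auto simp: connects_def)
  obtain N \<Gamma>' where N: "negligible N"
    and d: "\<And>s. s \<in> {0..S} - N \<Longrightarrow> (\<Gamma> has_vector_derivative \<Gamma>' s) (at s within {0..S})"
    and h: "\<And>s. s \<in> {0..S} - N \<Longrightarrow> \<Gamma>' s \<in> horizontal_space (\<Gamma> s)"
    using horizontal_curve_velocity[OF hor] by blast
  have ac: "abs_continuous_on_ivl 0 S \<Gamma>" using hor by (simp add: horizontal_curve_def)
  have proj: "heis_proj = (\<lambda>p::'n heis. (fst p, fst (snd p)))"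
    by (auto simp: heis_proj_def)
  have lin: "bounded_linear (heis_proj :: 'n heis \<Rightarrow> _)"
    unfolding proj
    by (intro bounded_linear_Pair bounded_linear_fst bounded_linear_compose[OF bounded_linear_fst bounded_linear_snd])
  have lin_t: "bounded_linear (\<lambda>p::'n heis. snd (snd p))"
    by (intro bounded_linear_compose[OF bounded_linear_snd bounded_linear_snd])
  define z where "z s = heis_proj (\<Gamma> s)" for s
  define z' where "z' s = heis_proj (\<Gamma>' s)" for s
  have int: "(\<Gamma>' has_integral \<Gamma> b - \<Gamma> a) {a..b}" if "0 \<le> a" "a \<le> b" "b \<le> S" for a b
  proof (rule has_integral_abs_continuous[OF _ \<open>a \<le> b\<close> N])
    show "abs_continuous_on_ivl a b \<Gamma>" using ac that by (auto intro: abs_continuous_on_subivl)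
    show "(\<Gamma> has_vector_derivative \<Gamma>' s) (at s within {a..b})" if "s \<in> {a..b} - N" for s
      using d[of s] that \<open>0 \<le> a\<close> \<open>b \<le> S\<close> by (auto intro: has_vector_derivative_within_subset)
  qed
  have "\<Gamma>' absolutely_integrable_on {0..S}"
    using S by (intro absolutely_integrable_abs_continuous[OF ac _ N d]) auto
  then have "z' absolutely_integrable_on {0..S}"
    unfolding z'_def using absolutely_integrable_linear[OF _ lin] by (auto simp: o_def)
  then have m: "(\<lambda>s. norm (z' s)) integrable_on {0..S}"
    by (simp add: absolutely_integrable_on_def)
  have "heis_length S \<Gamma> = integral {0..S} (\<lambda>s. norm (z' s))"
    unfolding heis_length_def
  proof (rule integral_spike[OF N])
    fix s assume s: "s \<in> {0..S} - N"
    have "((heis_proj \<circ> \<Gamma>) has_vector_derivative z' s) (at s within {0..S})"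
      unfolding z'_def o_def by (rule bounded_linear.has_vector_derivative[OF lin d[OF s]])
    then have "vector_derivative (heis_proj \<circ> \<Gamma>) (at s within {0..S}) = z' s"
      using s S by (intro vector_derivative_within_closed_interval) auto
    then show "norm (z' s) = norm (vector_derivative (heis_proj \<circ> \<Gamma>) (at s within {0..S}))" by simp
  qed
  moreover have "pi * (snd (snd (\<Gamma> S)) - snd (snd (\<Gamma> 0))) \<le> (integral {0..S} (\<lambda>s. norm (z' s)))\<^sup>2"
  proof (rule isoperimetric_lift[OF _ N _ _ m, where z = z and t' = "\<lambda>s. snd (snd (\<Gamma>' s))"])
    fix c d :: real assume cd: "0 \<le> c" "c \<le> d" "d \<le> S"
    show "(z' has_integral z d - z c) {c..d}"
      using has_integral_linear[OF int[OF cd] lin]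
      by (simp add: o_def z_def z'_def[abs_def] proj)
    show "((\<lambda>s. snd (snd (\<Gamma>' s))) has_integral snd (snd (\<Gamma> d)) - snd (snd (\<Gamma> c))) {c..d}"
      using has_integral_linear[OF int[OF cd] lin_t] by (simp add: o_def)
  next
    fix s assume s: "s \<in> {0..S} - N"
    obtain u v w where \<Gamma>': "\<Gamma>' s = (u, v, w)" by (metis surj_pair)
    obtain a b c where \<Gamma>: "\<Gamma> s = (a, b, c)" by (metis surj_pair)
    show "snd (snd (\<Gamma>' s)) = 2 * heis_form (z s) (z' s)"
      using h[OF s] unfolding \<Gamma> \<Gamma>' horizontal_space_iff z_def z'_def
      by (simp add: heis_proj_def heis_form_sum \<Gamma> \<Gamma>' mult.commute)
  qed (use S ends in \<open>auto simp: z_def heis_proj_def\<close>)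
  ultimately show ?thesis using ends by simp
qed

section \<open>Lifts of circles are geodesics\<close>

lemma abs_continuous_C1:
  fixes f :: "real \<Rightarrow> 'a::banach"
  assumes deriv: "\<And>x. x \<in> {a..b} \<Longrightarrow> (f has_vector_derivative f' x) (at x within {a..b})"
    and cont: "continuous_on {a..b} f'"
  shows "abs_continuous_on_ivl a b f"
proof -
  have "bounded (f' ` {a..b})" using cont by (intro compact_imp_bounded compact_continuous_image) auto
  then obtain B where B: "B > 0" "\<And>x. x \<in> {a..b} \<Longrightarrow> norm (f' x) \<le> B"
    unfolding bounded_pos by auto
  have lip: "norm (f d - f c) \<le> B * (d - c)" if "a \<le> c" "c \<le> d" "d \<le> b" for c d
  proof -
    have "(f has_vector_derivative f' x) (at x within {c..d})" if "x \<in> {c..d}" for x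
      using deriv[of x] that \<open>a \<le> c\<close> \<open>d \<le> b\<close> by (auto intro: has_vector_derivative_within_subset)
    then have "(f' has_integral (f d - f c)) {c..d}"
      using \<open>c \<le> d\<close> by (intro fundamental_theorem_of_calculus)
    then have "norm (f d - f c) \<le> B * measure lborel {c..d}"
      using B that by (intro has_integral_bound_real) auto
    then show ?thesis using \<open>c \<le> d\<close> by simp
  qed
  show ?thesis
    unfolding abs_continuous_on_ivl_def
  proof (intro allI impI)
    fix e :: real assume "e > 0"
    show "\<exists>d>0. \<forall>D. D division_of (\<Union>D) \<and> \<Union>D \<subseteq> {a..b} \<and> (\<Sum>k\<in>D. Sup k - Inf k) < d \<longrightarrow>
        (\<Sum>k\<in>D. norm (f (Sup k) - f (Inf k))) < e"
    proof (intro exI[of _ "e / B"] conjI allI impI)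
      fix D assume D: "D division_of (\<Union>D) \<and> \<Union>D \<subseteq> {a..b} \<and> (\<Sum>k\<in>D. Sup k - Inf k) < e / B"
      have "(\<Sum>k\<in>D. norm (f (Sup k) - f (Inf k))) \<le> (\<Sum>k\<in>D. B * (Sup k - Inf k))"
      proof (rule sum_mono)
        fix k assume k: "k \<in> D"
        then obtain u v where uv: "k = cbox u v" "k \<noteq> {}"
          using division_ofD(3,4) D by metis
        moreover have "k \<subseteq> {a..b}" using k D by blast
        ultimately show "norm (f (Sup k) - f (Inf k)) \<le> B * (Sup k - Inf k)"
          using lip[of u v] by auto
      qed
      also have "\<dots> = B * (\<Sum>k\<in>D. Sup k - Inf k)" by (rule sum_distrib_left[symmetric])
      also have "\<dots> < e" using D \<open>B > 0\<close> by (simp add: pos_less_divide_eq mult.commute)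
      finally show "(\<Sum>k\<in>D. norm (f (Sup k) - f (Inf k))) < e" .
    qed (use \<open>e > 0\<close> \<open>B > 0\<close> in simp)
  qed
qed

text \<open>
  With complex coordinates \<open>y + i x\<close>, the projection to \<open>\<real>\<^sup>2\<^sup>n = \<complex>\<^sup>n\<close> is the circle
  \<open>z + (e\<^sup>i\<^sup>s - 1) w\<close>, where \<open>z\<close> is the projection of \<open>p\<close> and \<open>w = b + i a\<close>; the last coordinate is the one that makes the curve horizontal.
\<close>

definition circle_lift :: "'n::finite heis \<Rightarrow> real ^ 'n \<Rightarrow> real ^ 'n \<Rightarrow> real \<Rightarrow> 'n heis" where
  "circle_lift p a b s = heis_mult p
     ((cos s - 1) *\<^sub>R a + sin s *\<^sub>R b, (cos s - 1) *\<^sub>R b - sin s *\<^sub>R a, 2 * (a \<bullet> a + b \<bullet> b) * (s - sin s))"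

text \<open>
  The lift has length \<open>2 \<pi> R\<^sup>1\<^sup>/\<^sup>2\<close> and rises by \<open>4 \<pi> R\<close>, where \<open>R\<close> is the squared radius of the circle.
  This is the case of equality in the isoperimetric inequality.
\<close>

lemma geodesic_circle_lift:
  fixes x y a b :: "real ^ 'n::finite"
  shows "geodesic (2 * pi) (circle_lift (x, y, t) a b) (x, y, t) (x, y, t + 4 * pi * (a \<bullet> a + b \<bullet> b))"
proof -
  define R where "R = a \<bullet> a + b \<bullet> b"
  define \<Gamma> where "\<Gamma> = circle_lift (x, y, t) a b"
  define u v where "u s = (cos s - 1) *\<^sub>R a + sin s *\<^sub>R b" and "v s = (cos s - 1) *\<^sub>R b - sin s *\<^sub>R a" for s
  define u' v' where "u' s = - sin s *\<^sub>R a + cos s *\<^sub>R b" and "v' s = - sin s *\<^sub>R b - cos s *\<^sub>R a" for s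
  define \<Gamma>' where "\<Gamma>' s = (u' s, v' s, 2 * R * (1 - cos s) + 2 * heis_form (x, y) (u' s, v' s))" for s
  have \<Gamma>: "\<Gamma> s = (x + u s, y + v s, t + 2 * R * (s - sin s) + 2 * heis_form (x, y) (u s, v s))" for s
    by (simp add: \<Gamma>_def circle_lift_def heis_mult_eq u_def v_def R_def)
  have trig: "(sin has_vector_derivative cos s) (at s within A)"
      "(cos has_vector_derivative - sin s) (at s within A)" for s :: real and A
    unfolding has_real_derivative_iff_has_vector_derivative[symmetric]
    by (auto intro!: derivative_eq_intros)
  have du: "(u has_vector_derivative u' s) (at s within A)" for s A
    unfolding u_def[abs_def] u'_def by (auto intro!: derivative_eq_intros trig)
  have dv: "(v has_vector_derivative v' s) (at s within A)" for s A
    unfolding v_def[abs_def] v'_def by (auto intro!: derivative_eq_intros trig)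
  have dw: "((\<lambda>s. heis_form (x, y) (u s, v s)) has_vector_derivative heis_form (x, y) (u' s, v' s)) (at s within A)" for s A
    by (intro bounded_linear.has_vector_derivative[OF bounded_linear_heis_form]
        has_vector_derivative_Pair du dv)
  have d\<Gamma>: "(\<Gamma> has_vector_derivative \<Gamma>' s) (at s within A)" for s A
    unfolding \<Gamma>[abs_def] \<Gamma>'_def
    by (intro has_vector_derivative_Pair)
      (auto intro!: derivative_eq_intros trig du dv dw simp: algebra_simps)
  have R: "u' s \<bullet> u' s + v' s \<bullet> v' s = R" for s
  proof -
    have "(- \<sigma> *\<^sub>R a + \<kappa> *\<^sub>R b) \<bullet> (- \<sigma> *\<^sub>R a + \<kappa> *\<^sub>R b)
        + (- \<sigma> *\<^sub>R b - \<kappa> *\<^sub>R a) \<bullet> (- \<sigma> *\<^sub>R b - \<kappa> *\<^sub>R a) = (\<sigma>\<^sup>2 + \<kappa>\<^sup>2) * R" for \<sigma> \<kappa> :: real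
      by (simp add: R_def inner_simps inner_commute algebra_simps power2_eq_square)
    then show ?thesis by (simp add: u'_def v'_def)
  qed
  have form: "heis_form (u s, v s) (u' s, v' s) = R * (1 - cos s)" for s
  proof -
    have "heis_form ((\<kappa> - 1) *\<^sub>R a + \<sigma> *\<^sub>R b, (\<kappa> - 1) *\<^sub>R b - \<sigma> *\<^sub>R a)
        (- \<sigma> *\<^sub>R a + \<kappa> *\<^sub>R b, - \<sigma> *\<^sub>R b - \<kappa> *\<^sub>R a) = (\<sigma>\<^sup>2 + \<kappa>\<^sup>2 - \<kappa>) * R" for \<sigma> \<kappa> :: real
      by (simp add: heis_form_def R_def inner_simps inner_commute algebra_simps power2_eq_square)
    then show ?thesis by (simp add: u_def v_def u'_def v'_def)
  qed
  have hor: "\<Gamma>' s \<in> horizontal_space (\<Gamma> s)" for s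
  proof -
    have "heis_form (x + u s, y + v s) (u' s, v' s) = heis_form (x, y) (u' s, v' s) + R * (1 - cos s)"
      using heis_form_distribs(1)[of "(x, y)" "(u s, v s)"] form by simp
    then show ?thesis
      unfolding \<Gamma> \<Gamma>'_def horizontal_space_iff by (simp add: heis_form_sum mult.commute)
  qed
  have ac: "abs_continuous_on_ivl 0 (2 * pi) \<Gamma>"
  proof (rule abs_continuous_C1[OF d\<Gamma>])
    show "continuous_on {0..2 * pi} \<Gamma>'"
      unfolding \<Gamma>'_def[abs_def] heis_form_def u'_def v'_def by (auto intro!: continuous_intros)
  qed
  have con: "connects (2 * pi) \<Gamma> (x, y, t) (x, y, t + 4 * pi * R)"
    unfolding connects_def horizontal_curve_def
  proof (intro conjI AE_I2)
    show "\<exists>v\<in>horizontal_space (\<Gamma> s). (\<Gamma> has_vector_derivative v) (at s within {0..2 * pi})" for s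
      using d\<Gamma> hor by blast
    show "\<Gamma> 0 = (x, y, t)" "\<Gamma> (2 * pi) = (x, y, t + 4 * pi * R)"
      by (simp_all add: \<Gamma> u_def v_def heis_form_def)
  qed (use ac in auto)
  have "heis_length (2 * pi) \<Gamma> = integral {0..2 * pi} (\<lambda>s. sqrt R)"
    unfolding heis_length_def
  proof (rule Henstock_Kurzweil_Integration.integral_cong)
    fix s assume s: "s \<in> {0..2 * pi}"
    have "heis_proj \<circ> \<Gamma> = (\<lambda>s. (x + u s, y + v s))" by (auto simp: heis_proj_def \<Gamma>)
    moreover have "((\<lambda>s. (x + u s, y + v s)) has_vector_derivative (u' s, v' s)) (at s within {0..2 * pi})"
      by (intro has_vector_derivative_Pair) (auto intro!: derivative_eq_intros du dv)
    ultimately have "vector_derivative (heis_proj \<circ> \<Gamma>) (at s within {0..2 * pi}) = (u' s, v' s)"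
      using s vector_derivative_within_closed_interval[of 0 "2 * pi" s] by auto
    then show "norm (vector_derivative (heis_proj \<circ> \<Gamma>) (at s within {0..2 * pi})) = sqrt R"
      using R[of s] by (simp add: norm_eq_sqrt_inner)
  qed
  then have "heis_length (2 * pi) \<Gamma> = 2 * pi * sqrt R" by simp
  moreover have "2 * pi * sqrt R \<le> heis_length S \<Delta>"
    if c: "connects S \<Delta> (x, y, t) (x, y, t + 4 * pi * R)" for S and \<Delta> :: "real \<Rightarrow> 'n heis"
  proof (rule power2_le_imp_le)
    have "R \<ge> 0" by (simp add: R_def)
    then have "(2 * pi * sqrt R)\<^sup>2 = pi * (4 * pi * R)" by (simp add: power_mult_distrib power2_eq_square)
    also have "\<dots> \<le> (heis_length S \<Delta>)\<^sup>2" using vertical_gap_le_length[OF c] by simp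
    finally show "(2 * pi * sqrt R)\<^sup>2 \<le> (heis_length S \<Delta>)\<^sup>2" .
    show "0 \<le> heis_length S \<Delta>"
    proof (cases "(\<lambda>s. norm (vector_derivative (heis_proj \<circ> \<Delta>) (at s within {0..S}))) integrable_on {0..S}")
      case True
      then show ?thesis
        unfolding heis_length_def by (rule Henstock_Kurzweil_Integration.integral_nonneg) simp
    qed (simp add: heis_length_def not_integrable_integral)
  qed
  ultimately have "geodesic (2 * pi) \<Gamma> (x, y, t) (x, y, t + 4 * pi * R)"
    using con unfolding geodesic_def by metis
  then show ?thesis by (simp add: \<Gamma>_def R_def)
qed

section \<open>Convex sets that meet a fibre twice\<close>

text \<open>
  Points are written with their projection to \<open>\<real>\<^sup>2\<^sup>n\<close> as one argument, because vertical lines are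
  the fibres of this projection.
\<close>

definition heis_point :: "(real ^ 'n::finite) \<times> (real ^ 'n) \<Rightarrow> real \<Rightarrow> 'n heis" where
  "heis_point z t = (fst z, snd z, t)"

text \<open>
  The geodesics over the circles through \<open>z\<close> of squared radius \<open>R\<close> join the two given points. The circle
  may be turned by any unitary rotation about \<open>z\<close>, so at the parameter \<open>s\<close> these geodesics pass over every
  point at distance \<open>2 R\<^sup>1\<^sup>/\<^sup>2 sin (s/2)\<close> from \<open>z\<close>.
\<close>

lemma circle_lift_mem:
  fixes z w :: "(real ^ 'n::finite) \<times> (real ^ 'n)"
  assumes X: "geodetically_convex X"
    and ends: "heis_point z t \<in> X" "heis_point z (t + 4 * pi * R) \<in> X"
    and s: "0 < s" "s < 2 * pi" and R: "(norm w)\<^sup>2 = 2 * R * (1 - cos s)"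
  shows "heis_point (z + w) (t + 2 * R * (s - sin s) + 2 * heis_form z w) \<in> X"
proof -
  obtain x y u v where zw: "z = (x, y)" "w = (u, v)" by (metis surj_pair)
  have "cos s < 1"
  proof -
    have "sin (s / 2) > 0" using s by (intro sin_gt_zero) auto
    then show ?thesis using cos_double_sin[of "s / 2"] by simp
  qed
  \<comment> \<open>The point \<open>b + i a\<close> is the solution \<open>(v + i u) / (e\<^sup>i\<^sup>s - 1)\<close>, and \<open>1 / (e\<^sup>i\<^sup>s - 1) = - 1/2 - i c\<close>.\<close>
  define c where "c = sin s / (2 * (1 - cos s))"
  define a b where "a = - (1/2) *\<^sub>R u - c *\<^sub>R v" and "b = - (1/2) *\<^sub>R v + c *\<^sub>R u"
  have sc: "(sin s)\<^sup>2 = (1 - cos s) * (1 + cos s)"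
    by (simp add: sin_squared_eq power2_eq_square algebra_simps)
  have c1: "sin s * c = (1 + cos s) / 2" "(1 - cos s) * c = sin s / 2"
  proof -
    show "(1 - cos s) * c = sin s / 2" using \<open>cos s < 1\<close> by (simp add: c_def nonzero_divide_eq_eq eq_divide_eq)
    have "sin s * c = (1 - cos s) * (1 + cos s) / ((1 - cos s) * 2)"
      unfolding sc[symmetric] by (simp add: c_def power2_eq_square)
    then show "sin s * c = (1 + cos s) / 2"
      using \<open>cos s < 1\<close> by (simp only: mult_divide_mult_cancel_left_if) simp
  qed
  have "(1/4 + c\<^sup>2) * (2 * (1 - cos s)) = 1"
  proof -
    have "(1/4 + c\<^sup>2) * (2 * (1 - cos s)) = (1 - cos s) / 2 + 2 * c * ((1 - cos s) * c)"
      by (simp add: algebra_simps power2_eq_square diff_divide_distrib)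
    also have "\<dots> = (1 - cos s) / 2 + sin s * c" by (simp only: c1(2)) simp
    also have "\<dots> = 1" by (simp add: c1(1) add_divide_distrib[symmetric])
    finally show ?thesis .
  qed
  moreover have "a \<bullet> a + b \<bullet> b = (1/4 + c\<^sup>2) * (u \<bullet> u + v \<bullet> v)"
    by (simp add: a_def b_def inner_simps inner_commute algebra_simps power2_eq_square)
  moreover have "u \<bullet> u + v \<bullet> v = 2 * R * (1 - cos s)"
    using R zw by (simp add: norm_prod_def power2_norm_eq_inner)
  ultimately have ab: "a \<bullet> a + b \<bullet> b = R" by (simp add: mult_ac)
  have coeff: "(1 - cos s) / 2 + sin s * c = 1" "(1 - cos s) * c - sin s / 2 = 0"
    by (simp_all add: c1 add_divide_distrib[symmetric])
  have u: "(cos s - 1) *\<^sub>R a + sin s *\<^sub>R b = u"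
  proof -
    have "(cos s - 1) *\<^sub>R a + sin s *\<^sub>R b
        = ((1 - cos s) / 2 + sin s * c) *\<^sub>R u + ((1 - cos s) * c - sin s / 2) *\<^sub>R v"
      by (simp add: a_def b_def algebra_simps diff_divide_distrib)
    then show ?thesis by (simp only: coeff) simp
  qed
  have v: "(cos s - 1) *\<^sub>R b - sin s *\<^sub>R a = v"
  proof -
    have "(cos s - 1) *\<^sub>R b - sin s *\<^sub>R a
        = ((1 - cos s) / 2 + sin s * c) *\<^sub>R v - ((1 - cos s) * c - sin s / 2) *\<^sub>R u"
      by (simp add: a_def b_def algebra_simps diff_divide_distrib)
    then show ?thesis by (simp only: coeff) simp
  qed
  have "circle_lift (x, y, t) a b ` {0..2 * pi} \<subseteq> X"
    using X ends geodesic_circle_lift[of x y t a b]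
    unfolding geodetically_convex_def ab by (auto simp: heis_point_def zw)
  moreover have "circle_lift (x, y, t) a b s = heis_point (z + w) (t + 2 * R * (s - sin s) + 2 * heis_form z w)"
    by (simp add: circle_lift_def ab u v heis_mult_eq heis_point_def zw)
  ultimately show ?thesis using s by (metis atLeastAtMost_iff image_subset_iff less_eq_real_def)
qed

text \<open>
  A circular segment with central angle \<open>2 \<sigma>\<close> has small area compared with the square of its chord
  when \<open>\<sigma>\<close> is small. The derivative of the difference is \<open>2 sin x (cos x - 2 sin x)\<close>, which is
  nonnegative as long as \<open>tan x \<le> 1/2\<close>, that is \<open>sin\<^sup>2 x \<le> 1/5\<close>.
\<close>

lemma circular_segment_le:
  fixes \<sigma> :: real
  assumes "0 \<le> \<sigma>" "\<sigma> \<le> pi / 2" "(sin \<sigma>)\<^sup>2 \<le> 1 / 5"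
  shows "2 * \<sigma> - sin (2 * \<sigma>) \<le> (sin \<sigma>)\<^sup>2"
proof -
  define h where "h x = (sin x)\<^sup>2 - 2 * x + sin (2 * x)" for x :: real
  have "h 0 \<le> h \<sigma>"
  proof (rule DERIV_nonneg_imp_nondecreasing[OF \<open>0 \<le> \<sigma>\<close>])
    fix x :: real assume x: "0 \<le> x" "x \<le> \<sigma>"
    have s: "0 \<le> sin x" "sin x \<le> sin \<sigma>"
      using x assms by (auto intro!: sin_ge_zero sin_monotone_2pi_le)
    have c: "0 \<le> cos x" using x assms by (intro cos_ge_zero) auto
    have "(sin x)\<^sup>2 \<le> 1 / 5" using s assms(3) by (smt (verit) power_mono)
    then have "(2 * sin x)\<^sup>2 \<le> (cos x)\<^sup>2" by (simp add: cos_squared_eq power_mult_distrib)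
    then have "2 * sin x \<le> cos x" using c by (rule power2_le_imp_le)
    then have "0 \<le> 2 * sin x * (cos x - 2 * sin x)" using s by simp
    also have "\<dots> = 2 * sin x * cos x - 2 + 2 * cos (2 * x)"
      unfolding cos_double_sin by (simp add: power2_eq_square algebra_simps)
    finally have "0 \<le> 2 * sin x * cos x - 2 + 2 * cos (2 * x)" .
    moreover have "(h has_real_derivative (2 * sin x * cos x - 2 + 2 * cos (2 * x))) (at x)"
      unfolding h_def[abs_def] by (auto intro!: derivative_eq_intros)
    ultimately show "\<exists>d. (h has_real_derivative d) (at x) \<and> 0 \<le> d" by blast
  qed
  then show ?thesis by (simp add: h_def)
qed

text \<open>
  From two points at height difference \<open>g\<close> over \<open>z\<close>, convexity yields two points over each \<open>z + w\<close> with
  \<open>\<pi> |w|\<^sup>2 \<le> g\<close>: the circles pass over \<open>z + w\<close> at the parameters \<open>s\<close> and \<open>2 \<pi> - s\<close>. The loss \<open>\<phi>\<close> of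
  height at each end depends only on \<open>g\<close> and \<open>|w|\<close>, hence the order of the quantifiers. For short \<open>w\<close> it
  is at most half of \<open>|w|\<^sup>2\<close>, whereas the term \<open>2 heis_form\<close> accumulated along a closed polygon
  can be as large as a bigger multiple of the squared edge length.
\<close>

lemma fibre_step:
  fixes X :: "'n::finite heis set"
  assumes X: "geodetically_convex X" and g: "0 < g" and r: "0 \<le> r" "pi * r\<^sup>2 \<le> g"
  shows "\<exists>\<phi>. 0 \<le> \<phi> \<and> (16 * r\<^sup>2 \<le> g \<longrightarrow> 2 * \<phi> \<le> r\<^sup>2) \<and>
    (\<forall>z t w. heis_point z t \<in> X \<longrightarrow> heis_point z (t + g) \<in> X \<longrightarrow> norm w = r \<longrightarrow>
      heis_point (z + w) (t + \<phi> + 2 * heis_form z w) \<in> X \<and>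
      heis_point (z + w) (t + g - \<phi> + 2 * heis_form z w) \<in> X)"
proof (cases "r = 0")
  case True
  then show ?thesis by (intro exI[of _ 0]) (auto simp: heis_form_def)
next
  case False
  then have "r > 0" using r by simp
  define R where "R = g / (4 * pi)"
  have "R > 0" using g by (simp add: R_def)
  have gR: "g = 4 * pi * R" by (simp add: R_def)
  have rR: "r\<^sup>2 \<le> 4 * R" using r(2) gR by simp
  define q where "q = r / (2 * sqrt R)"
  have q2: "q\<^sup>2 = r\<^sup>2 / (4 * R)" using \<open>R > 0\<close> by (simp add: q_def power_divide power_mult_distrib)
  have q: "0 < q" "q \<le> 1"
  proof -
    show "0 < q" using \<open>r > 0\<close> \<open>R > 0\<close> by (simp add: q_def)
    have "q\<^sup>2 \<le> 1\<^sup>2" using q2 rR \<open>R > 0\<close> by simp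
    then show "q \<le> 1" by (rule power2_le_imp_le) simp
  qed
  define \<sigma> where "\<sigma> = arcsin q"
  have \<sigma>: "0 < \<sigma>" "\<sigma> \<le> pi / 2" "sin \<sigma> = q"
    using q arcsin_less_mono[of 0 q] arcsin_ubound[of q] by (auto simp: \<sigma>_def)
  define \<phi> where "\<phi> = 2 * R * (2 * \<sigma> - sin (2 * \<sigma>))"
  have r_eq: "r\<^sup>2 = 2 * R * (1 - cos (2 * \<sigma>))"
    using \<open>R > 0\<close> q2 by (simp add: cos_double_sin \<sigma>)
  show ?thesis
  proof (intro exI[of _ \<phi>] conjI allI impI)
    show "0 \<le> \<phi>" using sin_x_le_x[of "2 * \<sigma>"] \<sigma> \<open>R > 0\<close> by (simp add: \<phi>_def)
    show "2 * \<phi> \<le> r\<^sup>2" if "16 * r\<^sup>2 \<le> g"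
    proof -
      have "pi < 16 / 5" using pi_approx by simp
      then have "5 * r\<^sup>2 \<le> 4 * R" using that gR \<open>R > 0\<close> mult_strict_right_mono[of pi "16 / 5" R] by linarith
      then have "(sin \<sigma>)\<^sup>2 \<le> 1 / 5" using \<open>R > 0\<close> by (simp add: \<sigma> q2 field_simps)
      then have "2 * \<sigma> - sin (2 * \<sigma>) \<le> (sin \<sigma>)\<^sup>2" using \<sigma> by (intro circular_segment_le) auto
      then have "2 * \<phi> \<le> 4 * R * q\<^sup>2" using \<open>R > 0\<close> by (simp add: \<phi>_def \<sigma>)
      then show ?thesis using q2 \<open>R > 0\<close> by simp
    qed
    fix z w :: "(real ^ 'n) \<times> (real ^ 'n)" and t
    assume z: "heis_point z t \<in> X" "heis_point z (t + g) \<in> X" and w: "norm w = r"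
    have z': "heis_point z (t + 4 * pi * R) \<in> X" using z(2) gR by simp
    show "heis_point (z + w) (t + \<phi> + 2 * heis_form z w) \<in> X"
      unfolding \<phi>_def using \<sigma> pi_gt_zero by (intro circle_lift_mem[OF X z(1) z']) (auto simp: w r_eq)
    have "heis_point (z + w) (t + 2 * R * ((2 * pi - 2 * \<sigma>) - sin (2 * pi - 2 * \<sigma>)) + 2 * heis_form z w) \<in> X"
      using \<sigma> pi_gt_zero by (intro circle_lift_mem[OF X z(1) z']) (auto simp: w r_eq)
    moreover have "2 * R * ((2 * pi - 2 * \<sigma>) - sin (2 * pi - 2 * \<sigma>)) = g - \<phi>"
      by (simp add: gR \<phi>_def sin_diff) (simp add: algebra_simps)
    ultimately show "heis_point (z + w) (t + g - \<phi> + 2 * heis_form z w) \<in> X"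
      by (simp only: add_diff_eq)
  qed
qed

text \<open>
  Four steps along the sides of a rhombus return to the same fibre. They lose the height \<open>\<Phi>\<close>, which
  depends only on the side length, and they gain \<open>\<alpha>\<close>, four times the signed area of the rhombus. For a
  fixed side length the area takes every value between plus and minus that of the square, and the loss is
  at most half of the largest gain. So the new points fill an interval around each old one.
\<close>

lemma fibre_loop:
  fixes X :: "'n::finite heis set" and z :: "(real ^ 'n) \<times> (real ^ 'n)"
  assumes X: "geodetically_convex X" and g: "0 < g"
    and z: "heis_point z t \<in> X" "heis_point z (t + g) \<in> X"
  obtains \<Phi> where "0 \<le> \<Phi>" "\<Phi> \<le> g / 10"
    "\<And>\<alpha>. \<bar>\<alpha>\<bar> \<le> g / 5 \<Longrightarrow> heis_point z (t + \<Phi> + \<alpha>) \<in> X \<and> heis_point z (t + g - \<Phi> + \<alpha>) \<in> X"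
proof -
  \<comment> \<open>Three steps reduce the gap to no less than \<open>g - 3 r\<^sup>2 = 17 r\<^sup>2\<close>, so the estimate \<open>2 \<phi> \<le> r\<^sup>2\<close>
      for gaps of at least \<open>16 r\<^sup>2\<close> applies to all four.\<close>
  define r where "r = sqrt (g / 20)"
  have r: "r > 0" "r\<^sup>2 = g / 20" using g by (simp_all add: r_def)
  have "pi < 4" using pi_less_4 .
  have step: "\<exists>\<phi>. 0 \<le> \<phi> \<and> 2 * \<phi> \<le> r\<^sup>2 \<and>
    (\<forall>z t w. heis_point z t \<in> X \<longrightarrow> heis_point z (t + h) \<in> X \<longrightarrow> norm w = r \<longrightarrow>
      heis_point (z + w) (t + \<phi> + 2 * heis_form z w) \<in> X \<and>
      heis_point (z + w) (t + h - \<phi> + 2 * heis_form z w) \<in> X)" if h: "g - 3 * r\<^sup>2 \<le> h" for h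
  proof -
    have "16 * r\<^sup>2 \<le> h" "0 < h" using h r g by auto
    moreover have "pi * r\<^sup>2 \<le> 16 * r\<^sup>2" using \<open>pi < 4\<close> by (intro mult_right_mono) auto
    ultimately show ?thesis using fibre_step[OF X \<open>0 < h\<close>, of r] r by auto
  qed
  obtain f1 where f1: "0 \<le> f1" "2 * f1 \<le> r\<^sup>2"
    "\<And>z t w. heis_point z t \<in> X \<Longrightarrow> heis_point z (t + g) \<in> X \<Longrightarrow> norm w = r \<Longrightarrow>
      heis_point (z + w) (t + f1 + 2 * heis_form z w) \<in> X \<and>
      heis_point (z + w) (t + g - f1 + 2 * heis_form z w) \<in> X"
    using step[of g] by (auto simp: r g)
  define g1 where "g1 = g - 2 * f1"
  obtain f2 where f2: "0 \<le> f2" "2 * f2 \<le> r\<^sup>2"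
    "\<And>z t w. heis_point z t \<in> X \<Longrightarrow> heis_point z (t + g1) \<in> X \<Longrightarrow> norm w = r \<Longrightarrow>
      heis_point (z + w) (t + f2 + 2 * heis_form z w) \<in> X \<and>
      heis_point (z + w) (t + g1 - f2 + 2 * heis_form z w) \<in> X"
    using step[of g1] f1(2) r g by (auto simp: g1_def)
  define g2 where "g2 = g1 - 2 * f2"
  obtain f3 where f3: "0 \<le> f3" "2 * f3 \<le> r\<^sup>2"
    "\<And>z t w. heis_point z t \<in> X \<Longrightarrow> heis_point z (t + g2) \<in> X \<Longrightarrow> norm w = r \<Longrightarrow>
      heis_point (z + w) (t + f3 + 2 * heis_form z w) \<in> X \<and>
      heis_point (z + w) (t + g2 - f3 + 2 * heis_form z w) \<in> X"
    using step[of g2] f1(2) f2(2) r g by (auto simp: g1_def g2_def)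
  define g3 where "g3 = g2 - 2 * f3"
  obtain f4 where f4: "0 \<le> f4" "2 * f4 \<le> r\<^sup>2"
    "\<And>z t w. heis_point z t \<in> X \<Longrightarrow> heis_point z (t + g3) \<in> X \<Longrightarrow> norm w = r \<Longrightarrow>
      heis_point (z + w) (t + f4 + 2 * heis_form z w) \<in> X \<and>
      heis_point (z + w) (t + g3 - f4 + 2 * heis_form z w) \<in> X"
    using step[of g3] f1(2) f2(2) f3(2) r g by (auto simp: g1_def g2_def g3_def)
  define \<Phi> where "\<Phi> = f1 + f2 + f3 + f4"
  show thesis
  proof (rule that[of \<Phi>])
    show "0 \<le> \<Phi>" "\<Phi> \<le> g / 10" using f1 f2 f3 f4 r by (auto simp: \<Phi>_def)
    fix \<alpha> :: real assume \<alpha>: "\<bar>\<alpha>\<bar> \<le> g / 5"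
    \<comment> \<open>The angle of the rhombus with four times the signed area \<open>- 4 r\<^sup>2 sin \<theta> = \<alpha>\<close>.\<close>
    define \<theta> where "\<theta> = arcsin (- 5 * \<alpha> / g)"
    have "\<bar>- 5 * \<alpha> / g\<bar> \<le> 1" using \<alpha> g by (simp add: abs_mult abs_divide pos_divide_le_eq)
    then have \<theta>: "sin \<theta> = - 5 * \<alpha> / g" unfolding \<theta>_def by (intro sin_arcsin) linarith+
    \<comment> \<open>The rhombus lies in the complex line of an arbitrary coordinate.\<close>
    define e :: "real ^ 'n" where "e = axis undefined 1"
    have e: "norm e = 1" "e \<bullet> e = 1" by (simp_all add: e_def inner_axis_axis)
    define a b where "a = (r *\<^sub>R e, 0 :: real ^ 'n)" and "b = ((r * cos \<theta>) *\<^sub>R e, (r * sin \<theta>) *\<^sub>R e)"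
    have na: "norm a = r" "norm (- a) = r" using r e by (simp_all add: a_def norm_Pair)
    have "norm b = sqrt (r\<^sup>2 * ((cos \<theta>)\<^sup>2 + (sin \<theta>)\<^sup>2))"
      by (simp add: b_def norm_Pair e power_mult_distrib distrib_left del: sin_cos_squared_add2 sin_cos_squared_add)
    then have nb: "norm b = r" "norm (- b) = r" using r(1) by simp_all
    have ab: "4 * heis_form a b = \<alpha>"
    proof -
      have "heis_form a b = - (r\<^sup>2 * sin \<theta>)" by (simp add: heis_form_def a_def b_def e power2_eq_square)
      then show ?thesis using \<theta> r g by simp
    qed
    have ba: "heis_form b a = - heis_form a b" by (rule heis_form_swap)
    define t1 where "t1 = t + f1 + 2 * heis_form z a"
    have p1: "heis_point (z + a) t1 \<in> X" "heis_point (z + a) (t1 + g1) \<in> X"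
      using f1(3)[OF z na(1)] by (auto simp: t1_def g1_def algebra_simps)
    define t2 where "t2 = t1 + f2 + 2 * heis_form (z + a) b"
    have p2: "heis_point (z + a + b) t2 \<in> X" "heis_point (z + a + b) (t2 + g2) \<in> X"
      using f2(3)[OF p1 nb(1)] by (auto simp: t2_def g2_def algebra_simps)
    define t3 where "t3 = t2 + f3 + 2 * heis_form (z + a + b) (- a)"
    have p3: "heis_point (z + b) t3 \<in> X" "heis_point (z + b) (t3 + g3) \<in> X"
      using f3(3)[OF p2 na(2)] by (auto simp: t3_def g3_def algebra_simps)
    define t4 where "t4 = t3 + f4 + 2 * heis_form (z + b) (- b)"
    have p4: "heis_point z t4 \<in> X" "heis_point z (t4 + g3 - 2 * f4) \<in> X"
      using f4(3)[OF p3 nb(2)] by (auto simp: t4_def algebra_simps)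
    have "t4 = t + \<Phi> + \<alpha>"
      unfolding ab[symmetric] t4_def t3_def t2_def t1_def \<Phi>_def heis_form_distribs heis_form_uminus ba
      by (simp add: algebra_simps)
    moreover from this have "t4 + g3 - 2 * f4 = t + g - \<Phi> + \<alpha>"
      by (simp add: g3_def g2_def g1_def \<Phi>_def)
    ultimately show "heis_point z (t + \<Phi> + \<alpha>) \<in> X \<and> heis_point z (t + g - \<Phi> + \<alpha>) \<in> X"
      using p4 by metis
  qed
qed

text \<open>
  Each round extends the gap downwards by a tenth of itself while the upper end stays. The gap grows
  without bound, and with it the interval around the upper end that the set contains.
\<close>

lemma fibre_subset:
  fixes X :: "'n::finite heis set" and z :: "(real ^ 'n) \<times> (real ^ 'n)"
  assumes X: "geodetically_convex X" and g: "0 < g"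
    and z: "heis_point z t \<in> X" "heis_point z (t + g) \<in> X"
  shows "heis_point z \<tau> \<in> X"
proof -
  have near: "heis_point z \<tau> \<in> X"
    if h: "0 < h" "heis_point z s \<in> X" "heis_point z (s + h) \<in> X" and
      \<tau>: "\<bar>\<tau> - s\<bar> \<le> h / 10 \<or> \<bar>\<tau> - (s + h)\<bar> \<le> h / 10" for s h \<tau>
  proof -
    obtain \<Phi> where \<Phi>: "0 \<le> \<Phi>" "\<Phi> \<le> h / 10"
      "\<And>\<alpha>. \<bar>\<alpha>\<bar> \<le> h / 5 \<Longrightarrow> heis_point z (s + \<Phi> + \<alpha>) \<in> X \<and> heis_point z (s + h - \<Phi> + \<alpha>) \<in> X"
      using fibre_loop[OF X h] by metis
    from \<tau> show ?thesis
    proof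
      assume "\<bar>\<tau> - s\<bar> \<le> h / 10"
      then have "\<bar>\<tau> - s - \<Phi>\<bar> \<le> h / 5" using \<Phi>(1,2) h(1) by linarith
      then show ?thesis using \<Phi>(3)[of "\<tau> - s - \<Phi>"] by simp
    next
      assume "\<bar>\<tau> - (s + h)\<bar> \<le> h / 10"
      then have "\<bar>\<tau> - (s + h) + \<Phi>\<bar> \<le> h / 5" using \<Phi>(1,2) h(1) by linarith
      then show ?thesis using \<Phi>(3)[of "\<tau> - (s + h) + \<Phi>"] by simp
    qed
  qed
  have down: "heis_point z (t + g - (11/10)^n * g) \<in> X" for n :: nat
  proof (induction n)
    case (Suc n)
    show ?case
      by (rule near[OF _ Suc.IH, of "(11/10)^n * g"]) (use g z in \<open>auto simp: algebra_simps\<close>)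
  qed (use z in simp)
  obtain n :: nat where "10 * \<bar>\<tau> - (t + g)\<bar> / g < (11/10)^n"
    using real_arch_pow[of "11/10"] by auto
  then have "\<bar>\<tau> - (t + g)\<bar> \<le> (11/10)^n * g / 10" using g by (simp add: field_simps)
  then have \<tau>: "\<bar>\<tau> - ((t + g - (11/10)^n * g) + (11/10)^n * g)\<bar> \<le> (11/10)^n * g / 10" by simp
  show ?thesis
  proof (rule near[OF _ down[of n] _ disjI2[OF \<tau>]])
    show "0 < (11/10)^n * g" using g by simp
    show "heis_point z (t + g - (11/10)^n * g + (11/10)^n * g) \<in> X" using z(2) by simp
  qed
qed

text \<open>
  Once a fibre is contained in the set, its points can be chosen with any gap, so one step reaches
  every other fibre at every height.
\<close>

lemma geodetically_convex_eq_UNIV: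
  fixes X :: "'n::finite heis set"
  assumes X: "geodetically_convex X" and z: "heis_point z s \<in> X" "heis_point z s' \<in> X" and "s < s'"
  shows "X = UNIV"
proof -
  have fibre: "heis_point z \<tau> \<in> X" for \<tau>
    using fibre_subset[OF X, of "s' - s" z s] z \<open>s < s'\<close> by simp
  have "p \<in> X" for p
  proof -
    obtain x y t where p: "p = (x, y, t)" by (metis surj_pair)
    define w where "w = (x, y) - z"
    define g where "g = pi * (norm w)\<^sup>2 + 1"
    have g: "0 < g" "pi * (norm w)\<^sup>2 \<le> g" by (simp_all add: g_def add_nonneg_pos)
    obtain \<phi> where "\<And>z t u. heis_point z t \<in> X \<Longrightarrow> heis_point z (t + g) \<in> X \<Longrightarrow> norm u = norm w \<Longrightarrow>
      heis_point (z + u) (t + \<phi> + 2 * heis_form z u) \<in> X"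
      using fibre_step[OF X g(1) norm_ge_zero g(2)] by blast
    then have "heis_point (z + w) ((t - \<phi> - 2 * heis_form z w) + \<phi> + 2 * heis_form z w) \<in> X"
      using fibre by blast
    then show ?thesis by (simp add: w_def heis_point_def p)
  qed
  then show ?thesis by blast
qed

theorem theorem1p3:
  fixes x y :: "real ^ 'n" and t t' :: real
  assumes "t \<noteq> t'"
  shows "geodetically_convex hull {(x, y, t), (x, y, t')} = UNIV"
proof -
  let ?H = "geodetically_convex hull {(x, y, t), (x, y, t')}"
  have "heis_point (x, y) t \<in> ?H" "heis_point (x, y) t' \<in> ?H"
    using hull_subset[of "{(x, y, t), (x, y, t')}" geodetically_convex] by (auto simp: heis_point_def)
  then show ?thesis
    using geodetically_convex_eq_UNIV[OF geodetically_convex_hull] assms by (metis linorder_neqE_linordered_idom)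
qed

end
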